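(* Up to projective equivalence, there are exactly two sets without tangents of size $10$ in $\mathrm{PG}(2,5)$: (i) the trivial set, namely the set of points on two distinct lines $L_1$ and $L_2$, other than $L_1\cap L_2$; (ii) the set of interior points of an irreducible conic in $\mathrm{PG}(2,5)$. These two sets are not projectively equivalent. *)

theory Defs
  imports Main
begin

text \<open>Concrete model of PG(2,5): homogeneous coordinates over GF(5) = integers mod 5.
  Vectors are integer triples, read modulo 5.\<close>

type_synonym vec = "int \<times> int \<times> int"
type_synonym mat = "vec \<times> vec \<times> vec"  \<comment> \<open>a 3x3 matrix given by its rows\<close>

fun dot :: "vec \<Rightarrow> vec \<Rightarrow> int" where
  "dot (a, b, c) (x, y, z) = a * x + b * y + c * z"

fun smul :: "int \<Rightarrow> vec \<Rightarrow> vec" where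
  "smul k (x, y, z) = (k * x, k * y, k * z)"

fun cong5 :: "vec \<Rightarrow> vec \<Rightarrow> bool" where
  "cong5 (a, b, c) (x, y, z) \<longleftrightarrow> a mod 5 = x mod 5 \<and> b mod 5 = y mod 5 \<and> c mod 5 = z mod 5"

text \<open>Points of PG(2,5): canonical representatives (first nonzero coordinate equal to 1,
  entries in {0..4}).  There are 31 of them.  Lines are represented dually by the same triples.\<close>
definition pts :: "vec set" where
  "pts = {(x, y, z). x \<in> {0..4} \<and> y \<in> {0..4} \<and> z \<in> {0..4} \<and>
           (x = 1 \<or> (x = 0 \<and> (y = 1 \<or> (y = 0 \<and> z = 1))))}"

definition incident :: "vec \<Rightarrow> vec \<Rightarrow> bool" where
  "incident l p \<longleftrightarrow> dot l p mod 5 = 0"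

definition line_set :: "vec \<Rightarrow> vec set" where
  "line_set l = {p \<in> pts. incident l p}"

definition tangent_free :: "vec set \<Rightarrow> bool" where
  "tangent_free S \<longleftrightarrow> S \<subseteq> pts \<and> (\<forall>l \<in> pts. card (S \<inter> line_set l) \<noteq> 1)"

fun mulv :: "mat \<Rightarrow> vec \<Rightarrow> vec" where
  "mulv (r1, r2, r3) v = (dot r1 v, dot r2 v, dot r3 v)"

fun det3 :: "mat \<Rightarrow> int" where
  "det3 ((a, b, c), (d, e, f), (g, h, i)) =
     a * (e * i - f * h) - b * (d * i - f * g) + c * (d * h - e * g)"

fun transp :: "mat \<Rightarrow> mat" where
  "transp ((a, b, c), (d, e, f), (g, h, i)) = ((a, d, g), (b, e, h), (c, f, i))"

definition invertible5 :: "mat \<Rightarrow> bool" where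
  "invertible5 M \<longleftrightarrow> det3 M mod 5 \<noteq> 0"

definition pimage :: "mat \<Rightarrow> vec set \<Rightarrow> vec set" where
  "pimage M S = {q \<in> pts. \<exists>p \<in> S. \<exists>k \<in> {1, 2, 3, 4}. cong5 (mulv M p) (smul k q)}"

definition proj_equiv :: "vec set \<Rightarrow> vec set \<Rightarrow> bool" where
  "proj_equiv S T \<longleftrightarrow> (\<exists>M. invertible5 M \<and> pimage M S = T)"

text \<open>Conics: zero sets of quadratic forms Q(v) = v^T A v with A symmetric (char 5 is odd,
  so every ternary quadratic form arises this way).  Irreducible = non-degenerate.\<close>
definition qform :: "mat \<Rightarrow> vec \<Rightarrow> int" where
  "qform A v = dot v (mulv A v)"

definition irreducible_conic_matrix :: "mat \<Rightarrow> bool" where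
  "irreducible_conic_matrix A \<longleftrightarrow> transp A = A \<and> det3 A mod 5 \<noteq> 0"

definition conic :: "mat \<Rightarrow> vec set" where
  "conic A = {p \<in> pts. qform A p mod 5 = 0}"

definition interior_pts :: "mat \<Rightarrow> vec set" where
  "interior_pts A = {p \<in> pts - conic A.
      \<forall>l \<in> pts. incident l p \<longrightarrow> card (conic A \<inter> line_set l) \<noteq> 1}"

definition trivial_set :: "vec set \<Rightarrow> bool" where
  "trivial_set S \<longleftrightarrow> (\<exists>l1 \<in> pts. \<exists>l2 \<in> pts. l1 \<noteq> l2 \<and>
      S = (line_set l1 \<union> line_set l2) - (line_set l1 \<inter> line_set l2))"

definition conic_interior_set :: "vec set \<Rightarrow> bool" where
  "conic_interior_set S \<longleftrightarrow> (\<exists>A. irreducible_conic_matrix A \<and> S = interior_pts A)"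

end

theory Submission
  imports Defs
begin

text \<open>Let \<open>S\<close> be tangent-free of size 10. The six lines through a point of \<open>S\<close> each contain
  a further point of \<open>S\<close>, so only three of the nine other points are in excess. If some line meets
  \<open>S\<close> in five points, every other line through one of them is a 2-secant; hence the remaining five
  points are collinear with the missing point of that line, and \<open>S\<close> is trivial. Otherwise double
  counting excludes 4-secants and leaves ten 3-secants, fifteen 2-secants and six external lines,
  and every point off \<open>S\<close> lies on one or two external lines. So the external lines form a dual
  6-arc covering exactly the complement of \<open>S\<close>. Four of them can be moved to a frame, and only three pairs complete
  the frame to a dual 6-arc, each giving the tangents of a conic with interior \<open>S\<close>. Diagonalising
  quadratic forms over GF(5) up to a scalar factor shows that all irreducible conics are
  projectively equivalent, and the existence of a 5-secant separates the two types.\<close>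

section \<open>Arithmetic modulo 5 and vectors up to a unit scalar\<close>

lemma cong5_dvd:
  "cong5 (a, b, c) (x, y, z) \<longleftrightarrow> 5 dvd a - x \<and> 5 dvd b - y \<and> 5 dvd c - z"
  by (simp add: mod_eq_dvd_iff)

lemma mod5_cases: "k mod 5 \<in> {0, 1, 2, 3, 4}" for k :: int
proof -
  have "k mod 5 = 0 \<or> k mod 5 = 1 \<or> k mod 5 = 2 \<or> k mod 5 = 3 \<or> k mod 5 = 4" by presburger
  then show ?thesis by simp
qed

lemma unit5_mult: "(k * l) mod 5 = 0 \<longleftrightarrow> k mod 5 = 0 \<or> l mod 5 = 0" for k l :: int
proof -
  have "(k * l) mod 5 = ((k mod 5) * (l mod 5)) mod 5" by (simp only: mod_mult_eq)
  then show ?thesis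
    using mod5_cases[of k] mod5_cases[of l] by (elim insertE) (simp_all del: mod_mod_trivial mod_0_imp_dvd)
qed

lemma unit5_multI: "k mod 5 \<noteq> 0 \<Longrightarrow> l mod 5 \<noteq> 0 \<Longrightarrow> (k * l) mod 5 \<noteq> 0" for k l :: int
  by (simp only: unit5_mult simp_thms)

text \<open>Equality of homogeneous coordinates. The scalar is any integer prime to 5 rather than a
  residue, so that products of scalars need no reduction in \<open>peq_trans\<close>.\<close>

definition peq :: "vec \<Rightarrow> vec \<Rightarrow> bool" where
  "peq v w \<longleftrightarrow> (\<exists>k. k mod 5 \<noteq> 0 \<and> cong5 v (smul k w))"

definition nonzero5 :: "vec \<Rightarrow> bool" where
  "nonzero5 v \<longleftrightarrow> \<not> cong5 v (0, 0, 0)"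

lemma peq_refl: "peq v v"
  unfolding peq_def by (cases v) (auto intro!: exI[of _ 1])

lemma peq_smul: "k mod 5 \<noteq> 0 \<Longrightarrow> peq (smul k v) v"
  unfolding peq_def by (cases v) (auto intro!: exI[of _ k])

lemma cong5_sym: "cong5 v w \<Longrightarrow> cong5 w v"
  by (cases v; cases w) simp

lemma cong5_trans: "cong5 u v \<Longrightarrow> cong5 v w \<Longrightarrow> cong5 u w"
  by (cases u; cases v; cases w) simp

lemma cong5_smul: "cong5 v w \<Longrightarrow> cong5 (smul k v) (smul k w)"
  by (cases v; cases w) (auto intro: mod_mult_cong)

lemma smul_smul: "smul k (smul l v) = smul (k * l) v"
  by (cases v) (simp add: mult.assoc)

lemma cong5_mulv: "cong5 v w \<Longrightarrow> cong5 (mulv M v) (mulv M w)"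
proof -
  have d: "dot r v mod 5 = dot r w mod 5" if "cong5 v w" for r
    using that by (cases r; cases v; cases w) (auto intro!: mod_add_cong intro: mod_mult_cong)
  assume "cong5 v w" then show ?thesis by (cases M) (simp add: d)
qed

lemma mulv_smul: "mulv M (smul k v) = smul k (mulv M v)"
  by (cases M; cases v) (auto simp: algebra_simps)

lemma unit5_inverse:
  fixes j :: int
  assumes "j mod 5 \<noteq> 0" shows "\<exists>k. k mod 5 \<noteq> 0 \<and> (k * j) mod 5 = 1"
proof -
  have "\<exists>k\<in>{1, 2, 3, 4}. (k * (j mod 5)) mod 5 = 1"
    using mod5_cases[of j] assms by (elim insertE) simp_all
  then obtain k where k: "k \<in> {1, 2, 3, 4}" "(k * (j mod 5)) mod 5 = 1" by blast
  moreover from k(2) have "(k * j) mod 5 = 1" by (simp only: mod_mult_right_eq)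
  moreover from k(1) have "k mod 5 \<noteq> 0" by auto
  ultimately show ?thesis by blast
qed

lemma peq_sym: assumes "peq v w" shows "peq w v"
proof -
  obtain k where k: "k mod 5 \<noteq> 0" "cong5 v (smul k w)" using assms unfolding peq_def by blast
  obtain l where l: "l mod 5 \<noteq> 0" "(l * k) mod 5 = 1" using unit5_inverse[OF k(1)] by blast
  have "l * k * x mod 5 = x mod 5" for x
    using mod_mult_left_eq[of "l * k" 5 x] l(2) by simp
  then have "cong5 (smul (l * k) w) w" by (cases w) simp
  moreover have "cong5 (smul l v) (smul (l * k) w)"
    using cong5_smul[OF k(2)] by (simp add: smul_smul)
  ultimately have "cong5 w (smul l v)" using cong5_trans cong5_sym by blast
  then show ?thesis unfolding peq_def using l by blast
qed

lemma peq_trans: assumes "peq u v" "peq v w" shows "peq u w"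
proof -
  obtain k where k: "k mod 5 \<noteq> 0" "cong5 u (smul k v)" using assms(1) unfolding peq_def by blast
  obtain l where l: "l mod 5 \<noteq> 0" "cong5 v (smul l w)" using assms(2) unfolding peq_def by blast
  have "cong5 u (smul (k * l) w)"
    using cong5_trans[OF k(2) cong5_smul[OF l(2)]] by (simp only: smul_smul)
  moreover have "(k * l) mod 5 \<noteq> 0" using k(1) l(1) by (rule unit5_multI)
  ultimately show ?thesis unfolding peq_def by blast
qed

lemma peq_mulv: assumes "peq v w" shows "peq (mulv M v) (mulv M w)"
proof -
  obtain k where k: "k mod 5 \<noteq> 0" "cong5 v (smul k w)" using assms unfolding peq_def by blast
  then have "cong5 (mulv M v) (smul k (mulv M w))" using cong5_mulv mulv_smul by metis
  then show ?thesis unfolding peq_def using k by blast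
qed

section \<open>Normalised representatives of projective points\<close>

lemma mod5_bound: "k mod 5 \<in> {0..4}" for k :: int
  by simp

lemma mem_pts: "(x, y, z) \<in> pts \<longleftrightarrow> x \<in> {0..4} \<and> y \<in> {0..4} \<and> z \<in> {0..4} \<and>
           (x = 1 \<or> (x = 0 \<and> (y = 1 \<or> (y = 0 \<and> z = 1))))"
  by (simp add: pts_def)

text \<open>The vector product. Its vanishing modulo 5 tests proportionality; otherwise it
  represents the line joining two points and, dually, the meet of two lines.\<close>

fun cross :: "vec \<Rightarrow> vec \<Rightarrow> vec" where
  "cross (a, b, c) (x, y, z) = (b * z - c * y, c * x - a * z, a * y - b * x)"

text \<open>Vanishing 2x2 minors force proportionality. The leading coordinates then stand in the
  same place, and as both equal 1 the factor is 1.\<close>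

lemma pts_eqI:
  assumes "p \<in> pts" "q \<in> pts" "\<not> nonzero5 (cross p q)" shows "p = q"
proof -
  obtain a b c x y z where [simp]: "p = (a, b, c)" "q = (x, y, z)" by (cases p; cases q)
  have e: "m = n" if "(m - n) mod 5 = 0" "0 \<le> m" "m \<le> 4" "0 \<le> n" "n \<le> 4" for m n :: int
    using that by presburger
  have "b = y" if "a = 1" "x = 1"
    using assms that e[of b y] e[of y b] by (simp add: mem_pts nonzero5_def)
  moreover have "c = z" if "a = 1" "x = 1"
    using assms that e[of c z] e[of z c] by (simp add: mem_pts nonzero5_def)
  moreover have "c = z" if "a = 0" "x = 0" "b = 1" "y = 1"
    using assms that e[of c z] e[of z c] by (simp add: mem_pts nonzero5_def)
  moreover have "a = 1 \<or> a = 0 \<and> (b = 1 \<or> b = 0 \<and> c = 1)"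
    "x = 1 \<or> x = 0 \<and> (y = 1 \<or> y = 0 \<and> z = 1)"
    using assms by (auto simp: mem_pts)
  moreover have "(b * z - c * y) mod 5 = 0" "(c * x - a * z) mod 5 = 0" "(a * y - b * x) mod 5 = 0"
    using assms(3) by (auto simp: nonzero5_def)
  ultimately show ?thesis by (elim disjE conjE) simp_all
qed

lemma peq_cross: assumes "peq p q" shows "\<not> nonzero5 (cross p q)"
proof -
  obtain a b c x y z where [simp]: "p = (a, b, c)" "q = (x, y, z)" by (cases p; cases q)
  obtain k where "5 dvd a - k * x" "5 dvd b - k * y" "5 dvd c - k * z"
    using assms by (auto simp: peq_def cong5_dvd simp del: cong5.simps)
  then obtain u v w where "a = k * x + 5 * u" "b = k * y + 5 * v" "c = k * z + 5 * w"
    unfolding dvd_def by (metis add.commute diff_add_cancel)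
  then have "b * z - c * y = 5 * (v * z - w * y)" "c * x - a * z = 5 * (w * x - u * z)"
    "a * y - b * x = 5 * (u * y - v * x)" by (auto simp: algebra_simps)
  then show ?thesis by (simp add: nonzero5_def)
qed

lemma peq_pts: "peq p q \<Longrightarrow> p \<in> pts \<Longrightarrow> q \<in> pts \<Longrightarrow> p = q"
  using pts_eqI peq_cross by blast

text \<open>Dividing by the first coordinate that is nonzero modulo 5 normalises the vector.\<close>

lemma ex_canon: assumes "nonzero5 v" shows "\<exists>q\<in>pts. peq v q"
proof -
  obtain a b c where [simp]: "v = (a, b, c)" by (cases v)
  define j where "j = (if a mod 5 \<noteq> 0 then a else if b mod 5 \<noteq> 0 then b else c)"
  have "j mod 5 \<noteq> 0" using assms by (auto simp: j_def nonzero5_def)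
  then obtain k where k: "k mod 5 \<noteq> 0" "(k * j) mod 5 = 1" using unit5_inverse by blast
  have z: "k * x mod 5 = 0" if "x mod 5 = 0" for x using that by (simp only: unit5_mult simp_thms)
  define q where "q = (k * a mod 5, k * b mod 5, k * c mod 5)"
  have "j = a \<or> a mod 5 = 0 \<and> (j = b \<or> b mod 5 = 0 \<and> j = c)" by (simp add: j_def)
  then have "k * a mod 5 = 1 \<or> k * a mod 5 = 0 \<and> (k * b mod 5 = 1 \<or> k * b mod 5 = 0 \<and> k * c mod 5 = 1)"
    using k(2) z[of a] z[of b] by metis
  then have "q \<in> pts" unfolding q_def mem_pts using mod5_bound by blast
  moreover have "peq v q"
    by (rule peq_sym) (use k in \<open>auto simp: peq_def q_def\<close>)
  ultimately show ?thesis by blast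
qed

section \<open>Projectivities\<close>

text \<open>On \<open>nonzero5\<close> vectors the choice is unique, by
  \<open>peq_pts\<close>.\<close>

definition canon :: "vec \<Rightarrow> vec" where
  "canon v = (SOME q. q \<in> pts \<and> peq v q)"

lemma canon:
  assumes "nonzero5 v" shows "canon v \<in> pts" "peq v (canon v)"
proof -
  have "\<exists>q. q \<in> pts \<and> peq v q" using ex_canon[OF assms] by blast
  from someI_ex[OF this] show "canon v \<in> pts" "peq v (canon v)" by (simp_all add: canon_def)
qed

lemma canon_eqI: "peq v q \<Longrightarrow> q \<in> pts \<Longrightarrow> nonzero5 v \<Longrightarrow> canon v = q"
  by (meson canon peq_pts peq_sym peq_trans)

lemma nonzero5_peq: assumes "peq v w" shows "nonzero5 v \<longleftrightarrow> nonzero5 w"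
proof -
  obtain k where k: "k mod 5 \<noteq> 0" "cong5 v (smul k w)" using assms unfolding peq_def by blast
  have "cong5 (smul k w) (0, 0, 0) \<longleftrightarrow> cong5 w (0, 0, 0)"
    using k(1) by (cases w) (simp only: smul.simps cong5.simps unit5_mult mod_0 simp_thms)
  then show ?thesis unfolding nonzero5_def using k(2) cong5_trans cong5_sym by blast
qed

lemma nonzero5_pts: "p \<in> pts \<Longrightarrow> nonzero5 p"
  by (cases p) (auto simp: mem_pts nonzero5_def)

text \<open>Replaces the inverse matrix while keeping integer entries: composing it with
  \<open>M\<close> multiplies by \<open>det3 M\<close>, a unit modulo 5 for invertible
  \<open>M\<close> and hence the identity on projective points.\<close>

fun adjugate :: "mat \<Rightarrow> mat" where
  "adjugate ((a, b, c), (d, e, f), (g, h, i)) =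
     ((e * i - f * h, c * h - b * i, b * f - c * e),
      (f * g - d * i, a * i - c * g, c * d - a * f),
      (d * h - e * g, b * g - a * h, a * e - b * d))"

fun mmul :: "mat \<Rightarrow> mat \<Rightarrow> mat" where
  "mmul (r1, r2, r3) N =
     (mulv (transp N) r1, mulv (transp N) r2, mulv (transp N) r3)"

lemma mat_cases: obtains a b c d e f g h i where "M = ((a, b, c), (d, e, f), (g, h, i :: int))"
  by (cases M) auto

lemma mulv_mmul: "mulv (mmul M N) v = mulv M (mulv N v)"
  by (rule mat_cases[of M]; rule mat_cases[of N]; cases v) (simp add: algebra_simps)

lemma det3_mmul: "det3 (mmul M N) = det3 M * det3 N"
  by (rule mat_cases[of M]; rule mat_cases[of N]) (simp add: algebra_simps)

lemma det3_transp: "det3 (transp M) = det3 M"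
  by (rule mat_cases[of M]) (simp add: algebra_simps)

lemma det3_adjugate: "det3 (adjugate M) = det3 M * det3 M"
  by (rule mat_cases[of M]) (simp add: algebra_simps)

lemma transp_transp: "transp (transp M) = M"
  by (rule mat_cases[of M]) simp

lemma adjugate_mulv: "mulv (adjugate M) (mulv M v) = smul (det3 M) v"
  by (rule mat_cases[of M]; cases v) (simp add: algebra_simps)

lemma mulv_adjugate: "mulv M (mulv (adjugate M) v) = smul (det3 M) v"
  by (rule mat_cases[of M]; cases v) (simp add: algebra_simps)

lemma dot_mulv: "dot l (mulv M v) = dot (mulv (transp M) l) v"
  by (rule mat_cases[of M]; cases v; cases l) (simp add: algebra_simps)

lemma invertible5_adjugate: "invertible5 M \<Longrightarrow> invertible5 (adjugate M)"
  unfolding invertible5_def det3_adjugate by (intro unit5_multI)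

lemma invertible5_transp: "invertible5 (transp M) \<longleftrightarrow> invertible5 M"
  unfolding invertible5_def det3_transp ..

lemma invertible5_mmul: "invertible5 M \<Longrightarrow> invertible5 N \<Longrightarrow> invertible5 (mmul M N)"
  unfolding invertible5_def det3_mmul by (rule unit5_multI)

lemma nonzero5_smul: "k mod 5 \<noteq> 0 \<Longrightarrow> nonzero5 (smul k v) \<longleftrightarrow> nonzero5 v"
  using nonzero5_peq peq_smul by blast

lemma mulv_zero: "mulv M (0, 0, 0) = (0, 0, 0)"
  by (rule mat_cases[of M]) simp

lemma nonzero5_mulv: assumes "invertible5 M" "nonzero5 v" shows "nonzero5 (mulv M v)"
proof (rule ccontr)
  assume "\<not> nonzero5 (mulv M v)"
  then have "cong5 (mulv M v) (0, 0, 0)" by (simp add: nonzero5_def)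
  from cong5_mulv[OF this, of "adjugate M"] have "cong5 (smul (det3 M) v) (0, 0, 0)"
    by (simp only: adjugate_mulv mulv_zero)
  then show False using assms nonzero5_smul unfolding nonzero5_def invertible5_def by blast
qed

definition act :: "mat \<Rightarrow> vec \<Rightarrow> vec" where
  "act M p = canon (mulv M p)"

lemma act_in_pts: "invertible5 M \<Longrightarrow> p \<in> pts \<Longrightarrow> act M p \<in> pts"
  unfolding act_def by (intro canon nonzero5_mulv nonzero5_pts)

lemma peq_act: "invertible5 M \<Longrightarrow> p \<in> pts \<Longrightarrow> peq (mulv M p) (act M p)"
  unfolding act_def by (intro canon nonzero5_mulv nonzero5_pts)

lemma act_eqI: "invertible5 M \<Longrightarrow> p \<in> pts \<Longrightarrow> q \<in> pts \<Longrightarrow> peq (mulv M p) q \<Longrightarrow> act M p = q"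
  unfolding act_def by (intro canon_eqI nonzero5_mulv nonzero5_pts)

lemma act_mmul:
  assumes "invertible5 M" "invertible5 N" "p \<in> pts"
  shows "act (mmul M N) p = act M (act N p)"
proof (rule act_eqI)
  have N: "act N p \<in> pts" using assms(2,3) by (rule act_in_pts)
  show "act M (act N p) \<in> pts" using assms(1) N by (rule act_in_pts)
  have "peq (mulv M (mulv N p)) (mulv M (act N p))" by (intro peq_mulv peq_act assms)
  then show "peq (mulv (mmul M N) p) (act M (act N p))"
    unfolding mulv_mmul using peq_act[OF assms(1) N] by (rule peq_trans)
qed (use assms invertible5_mmul in blast)+

lemma act_adjugate:
  assumes "invertible5 M" "p \<in> pts"
  shows "act (adjugate M) (act M p) = p" "act M (act (adjugate M) p) = p"
proof -
  have d: "det3 M mod 5 \<noteq> 0" using assms(1) by (simp only: invertible5_def not_False_eq_True)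
  note i = assms(1) invertible5_adjugate[OF assms(1)]
  have "peq (mulv (adjugate M) (act M p)) (mulv (adjugate M) (mulv M p))"
    by (intro peq_mulv peq_sym[OF peq_act] assms)
  then have "peq (mulv (adjugate M) (act M p)) p"
    unfolding adjugate_mulv using peq_smul[OF d] peq_trans by blast
  then show "act (adjugate M) (act M p) = p"
    by (intro act_eqI act_in_pts i assms)
  have "peq (mulv M (act (adjugate M) p)) (mulv M (mulv (adjugate M) p))"
    by (intro peq_mulv peq_sym[OF peq_act] i assms)
  then have "peq (mulv M (act (adjugate M) p)) p"
    unfolding mulv_adjugate using peq_smul[OF d] peq_trans by blast
  then show "act M (act (adjugate M) p) = p"
    by (intro act_eqI act_in_pts i assms)
qed

lemma bij_betw_act: assumes "invertible5 M" shows "bij_betw (act M) pts pts"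
  using assms
  by (intro bij_betw_byWitness[where f' = "act (adjugate M)"])
    (auto simp: act_adjugate act_in_pts invertible5_adjugate)

text \<open>Turns the relational image of the statement into the image under a point map. The
  scalars 1 to 4 in \<open>pimage\<close> suffice because any unit can be reduced modulo 5.\<close>

lemma pimage_eq_act_image:
  assumes "invertible5 M" "S \<subseteq> pts" shows "pimage M S = act M ` S"
proof -
  have *: "(\<exists>k\<in>{1, 2, 3, 4}. cong5 v (smul k q)) \<longleftrightarrow> peq v q" for v q
  proof
    assume "\<exists>k\<in>{1, 2, 3, 4}. cong5 v (smul k q)"
    then obtain k where k: "k \<in> {1, 2, 3, 4}" "cong5 v (smul k q)" by blast
    then have "k mod 5 \<noteq> 0" by auto
    then show "peq v q" using k unfolding peq_def by blast
  next
    assume "peq v q"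
    then obtain k where k: "k mod 5 \<noteq> 0" "cong5 v (smul k q)" unfolding peq_def by blast
    have "cong5 (smul k q) (smul (k mod 5) q)" by (cases q) (simp add: mod_mult_left_eq)
    then have "cong5 v (smul (k mod 5) q)" using k(2) cong5_trans by blast
    moreover have "k mod 5 \<in> {1, 2, 3, 4}" using k(1) mod5_cases[of k] by blast
    ultimately show "\<exists>k\<in>{1, 2, 3, 4}. cong5 v (smul k q)" by blast
  qed
  show ?thesis
  proof
    show "pimage M S \<subseteq> act M ` S"
    proof
      fix q assume "q \<in> pimage M S"
      then obtain p where p: "p \<in> S" "q \<in> pts" "peq (mulv M p) q" unfolding pimage_def * by blast
      then have "act M p = q" using assms by (intro act_eqI) auto
      then show "q \<in> act M ` S" using p by blast
    qed
    show "act M ` S \<subseteq> pimage M S"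
    proof
      fix q assume "q \<in> act M ` S"
      then obtain p where p: "p \<in> S" "q = act M p" by blast
      then have "p \<in> pts" using assms by blast
      then have "q \<in> pts" "peq (mulv M p) q" unfolding p using assms(1) act_in_pts peq_act by blast+
      then show "q \<in> pimage M S" using p(1) unfolding pimage_def * by blast
    qed
  qed
qed

text \<open>Since \<open>pimage\<close> only yields subsets of \<open>pts\<close>, reflexivity and
  symmetry of \<open>proj_equiv\<close> hold only for such sets; this is why the inclusion recurs as
  a hypothesis.\<close>

lemma proj_equiv_refl: assumes "S \<subseteq> pts" shows "proj_equiv S S"
proof -
  define I :: mat where "I = ((1, 0, 0), (0, 1, 0), (0, 0, 1))"
  have i: "invertible5 I" by (simp add: I_def invertible5_def)
  have "mulv I p = p" for p by (cases p) (simp add: I_def)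
  then have "act I p = p" if "p \<in> pts" for p
    using that i by (intro act_eqI) (simp_all add: peq_refl)
  then have "act I p = p" if "p \<in> S" for p using that assms by blast
  then have "act I ` S = S" by simp
  then have "pimage I S = S" using pimage_eq_act_image[OF i assms] by simp
  then show ?thesis using i unfolding proj_equiv_def by blast
qed

lemma proj_equivD:
  assumes "proj_equiv S T" "S \<subseteq> pts"
  obtains M where "invertible5 M" "T = act M ` S" "T \<subseteq> pts"
proof -
  obtain M where M: "invertible5 M" "pimage M S = T" using assms(1) unfolding proj_equiv_def by blast
  then have "T = act M ` S" using pimage_eq_act_image assms(2) by blast
  moreover have "T \<subseteq> pts" using M(2) unfolding pimage_def by blast
  ultimately show thesis using that M(1) by blast
qed

lemma proj_equivI: "invertible5 M \<Longrightarrow> S \<subseteq> pts \<Longrightarrow> act M ` S = T \<Longrightarrow> proj_equiv S T"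
  unfolding proj_equiv_def using pimage_eq_act_image by blast

lemma proj_equiv_sym: assumes "proj_equiv S T" "S \<subseteq> pts" shows "proj_equiv T S"
proof -
  obtain M where M: "invertible5 M" "T = act M ` S" "T \<subseteq> pts" using proj_equivD[OF assms] .
  have "act (adjugate M) (act M p) = p" if "p \<in> S" for p
    using that assms(2) act_adjugate(1)[OF M(1)] by blast
  then have "act (adjugate M) ` T = S" unfolding M(2) image_image by simp
  then show ?thesis by (rule proj_equivI[OF invertible5_adjugate[OF M(1)] M(3)])
qed

lemma proj_equiv_trans:
  assumes "proj_equiv S T" "proj_equiv T U" "S \<subseteq> pts" shows "proj_equiv S U"
proof -
  obtain M where M: "invertible5 M" "T = act M ` S" "T \<subseteq> pts" using proj_equivD[OF assms(1,3)] .
  obtain N where N: "invertible5 N" "U = act N ` T" "U \<subseteq> pts" using proj_equivD[OF assms(2) M(3)] .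
  have "act (mmul N M) ` S = U"
    unfolding M N image_image using assms(3) act_mmul[OF N(1) M(1)] by (intro image_cong refl) blast
  then show ?thesis by (rule proj_equivI[OF invertible5_mmul[OF N(1) M(1)] assms(3)])
qed

section \<open>Incidence and intersection numbers under projectivities\<close>

lemma incident_sym: "incident l p \<longleftrightarrow> incident p l"
  by (cases l; cases p) (simp add: incident_def mult.commute)

lemma incident_peq:
  assumes "peq p q" shows "incident l p \<longleftrightarrow> incident l q" "incident p l \<longleftrightarrow> incident q l"
proof -
  obtain k where k: "k mod 5 \<noteq> 0" "cong5 p (smul k q)" using assms unfolding peq_def by blast
  \<comment> \<open>A matrix with all rows equal to \<open>l\<close> turns the congruence for
    \<open>mulv\<close> into one for \<open>dot l\<close>.\<close>
  have "dot l p mod 5 = dot l (smul k q) mod 5"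
    using cong5_mulv[OF k(2), of "(l, l, l)"] by simp
  also have "dot l (smul k q) = k * dot l q" by (cases l; cases q) (simp add: algebra_simps)
  finally show 1: "incident l p \<longleftrightarrow> incident l q"
    unfolding incident_def using k(1) by (simp only: unit5_mult simp_thms)
  show "incident p l \<longleftrightarrow> incident q l" using 1 by (simp only: incident_sym[of _ l])
qed

lemma incident_mulv: "incident l (mulv M p) \<longleftrightarrow> incident (mulv (transp M) l) p"
  by (simp add: incident_def dot_mulv)

lemma incident_act:
  assumes "invertible5 M" "p \<in> pts" shows "incident l (act M p) \<longleftrightarrow> incident (mulv (transp M) l) p"
  using incident_peq(1)[OF peq_act[OF assms]] incident_mulv by blast

text \<open>Lines pull back along \<open>M\<close> by the transpose, because
  \<open>l . (M p) = (M^T l) . p\<close>.\<close>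

lemma incident_act_transp:
  assumes "invertible5 M" "p \<in> pts" "l \<in> pts"
  shows "incident l (act M p) \<longleftrightarrow> incident (act (transp M) l) p"
  using incident_act[OF assms(1,2)] incident_peq(2)[OF peq_act[OF _ assms(3)]] invertible5_transp assms(1)
  by blast

lemma card_act_line:
  assumes "invertible5 M" "S \<subseteq> pts" "l \<in> pts"
  shows "card (act M ` S \<inter> line_set l) = card (S \<inter> line_set (act (transp M) l))"
proof -
  have "act M ` S \<inter> line_set l = act M ` (S \<inter> line_set (act (transp M) l))"
  proof (intro equalityI subsetI)
    fix q assume "q \<in> act M ` S \<inter> line_set l"
    then obtain p where p: "p \<in> S" "q = act M p" "incident l q" unfolding line_set_def by blast
    then have "p \<in> pts" using assms(2) by blast
    then have "p \<in> line_set (act (transp M) l)"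
      unfolding line_set_def using p incident_act_transp[OF assms(1) _ assms(3)] by blast
    then show "q \<in> act M ` (S \<inter> line_set (act (transp M) l))" using p by blast
  next
    fix q assume "q \<in> act M ` (S \<inter> line_set (act (transp M) l))"
    then obtain p where p: "p \<in> S" "q = act M p" "p \<in> pts" "incident (act (transp M) l) p"
      unfolding line_set_def by blast
    then have "q \<in> line_set l"
      unfolding line_set_def using incident_act_transp[OF assms(1) _ assms(3)] act_in_pts[OF assms(1)] by blast
    then show "q \<in> act M ` S \<inter> line_set l" using p by blast
  qed
  moreover have "inj_on (act M) (S \<inter> line_set (act (transp M) l))"
    using bij_betw_act[OF assms(1)] assms(2) by (meson bij_betw_def inj_on_subset le_infI1)
  ultimately show ?thesis by (simp add: card_image)
qed

lemma card_act: assumes "invertible5 M" "S \<subseteq> pts" shows "card (act M ` S) = card S"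
  using bij_betw_act[OF assms(1)] assms(2) by (meson bij_betw_def card_image inj_on_subset)

text \<open>The set of occurring intersection numbers is a projective invariant. The case
  \<open>n = 1\<close> transports tangent-freeness, \<open>n = 5\<close> separates the two types,
  and arbitrary \<open>n\<close> transports the absence of lines with five or more points.\<close>

lemma line_card_proj_equiv:
  assumes "proj_equiv S T" "S \<subseteq> pts"
  shows "(\<exists>l\<in>pts. card (S \<inter> line_set l) = n) \<longleftrightarrow> (\<exists>l\<in>pts. card (T \<inter> line_set l) = n)"
proof -
  have *: "\<exists>l\<in>pts. card (S \<inter> line_set l) = n"
    if a: "proj_equiv S T" "S \<subseteq> pts" "\<exists>l\<in>pts. card (T \<inter> line_set l) = n" for S T
  proof -
    obtain M where M: "invertible5 M" "T = act M ` S" "T \<subseteq> pts" using proj_equivD[OF a(1,2)] .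
    obtain l where l: "l \<in> pts" "card (T \<inter> line_set l) = n" using a(3) by blast
    have "act (transp M) l \<in> pts" using M(1) l(1) act_in_pts invertible5_transp by blast
    moreover have "card (S \<inter> line_set (act (transp M) l)) = n"
      using card_act_line[OF M(1) a(2) l(1)] l(2) M(2) by simp
    ultimately show ?thesis by blast
  qed
  have "T \<subseteq> pts" using proj_equivD[OF assms] by blast
  then show ?thesis using *[OF assms] *[OF proj_equiv_sym[OF assms]] by blast
qed

lemma tangent_free_proj_equiv:
  assumes "proj_equiv S T" "tangent_free S" shows "tangent_free T"
proof -
  have S: "S \<subseteq> pts" using assms(2) unfolding tangent_free_def by blast
  then have "T \<subseteq> pts" using proj_equivD[OF assms(1)] by blast
  then show ?thesis using line_card_proj_equiv[OF assms(1) S, of 1] assms(2)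
    unfolding tangent_free_def by blast
qed

lemma card_proj_equiv:
  assumes "proj_equiv S T" "S \<subseteq> pts" shows "card T = card S"
proof -
  obtain M where "invertible5 M" "T = act M ` S" "T \<subseteq> pts" using proj_equivD[OF assms] .
  then show ?thesis using card_act[OF _ assms(2)] by simp
qed

section \<open>Trivial sets and conics\<close>

text \<open>An explicit enumeration of the plane, so that counting statements can be settled by
  evaluation.\<close>

definition point_list :: "vec list" where
  "point_list = concat (map (\<lambda>y. map (\<lambda>z. (1, y, z)) [0, 1, 2, 3, 4]) [0, 1, 2, 3, 4])
     @ map (\<lambda>z. (0, 1, z)) [0, 1, 2, 3, 4] @ [(0, 0, 1)]"

lemma pts_eq_set_point_list: "pts = set point_list"
proof -
  define L :: "int list" where "L = [0, 1, 2, 3, 4]"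
  have L: "set L = {0..4}" unfolding L_def by (simp add: set_eq_iff) presburger
  have "set point_list = {(x, y, z). x = 1 \<and> y \<in> {0..4} \<and> z \<in> {0..4}} \<union>
      {(x, y, z). x = 0 \<and> y = 1 \<and> z \<in> {0..4}} \<union> {(0, 0, 1)}"
    unfolding point_list_def L_def[symmetric] L[symmetric] by auto
  then show ?thesis unfolding pts_def by auto
qed

lemma distinct_point_list: "distinct point_list"
  by (simp add: point_list_def)

lemma finite_pts: "finite pts"
  by (simp add: pts_eq_set_point_list)

lemma Collect_pts: "{p \<in> pts. P p} = set (filter P point_list)"
  by (auto simp: pts_eq_set_point_list)

lemma card_Collect_pts: "card {p \<in> pts. P p} = length (filter P point_list)"
  unfolding Collect_pts by (intro distinct_card distinct_filter distinct_point_list)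

lemma card_pts: "card pts = 31"
  using distinct_card[OF distinct_point_list] by (simp add: pts_eq_set_point_list point_list_def)

lemma card_lines_through: assumes "p \<in> pts" shows "card {l \<in> pts. incident l p} = 6"
proof -
  have "list_all (\<lambda>p. length (filter (\<lambda>l. incident l p) point_list) = 6) point_list"
    by code_simp
  then show ?thesis using assms unfolding card_Collect_pts list_all_iff pts_eq_set_point_list[symmetric] by blast
qed

text \<open>The reference trivial set, on the lines \<open>x = 0\<close> and \<open>y = 0\<close>;
  the inequality of truth values expresses the symmetric difference.\<close>

definition cross_set :: "vec set" where
  "cross_set = {p \<in> pts. incident (1, 0, 0) p \<noteq> incident (0, 1, 0) p}"

lemma card_filter_line:
  "card ({p \<in> pts. P p} \<inter> line_set l) = length (filter (\<lambda>p. P p \<and> incident l p) point_list)"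
proof -
  have "{p \<in> pts. P p} \<inter> line_set l = {p \<in> pts. P p \<and> incident l p}" by (auto simp: line_set_def)
  then show ?thesis by (simp only: card_Collect_pts)
qed

lemma cross_set_properties:
  "tangent_free cross_set" "card cross_set = 10"
  "\<exists>l\<in>pts. card (cross_set \<inter> line_set l) = 5"
proof -
  have "list_all (\<lambda>l. length (filter (\<lambda>p. incident (1, 0, 0) p \<noteq> incident (0, 1, 0) p \<and>
      incident l p) point_list) \<noteq> 1) point_list"
    by code_simp
  then show "tangent_free cross_set"
    unfolding tangent_free_def cross_set_def card_filter_line list_all_iff pts_eq_set_point_list[symmetric]
    by blast
  show "card cross_set = 10" unfolding cross_set_def card_Collect_pts by code_simp
  have "card (cross_set \<inter> line_set (1, 0, 0)) = 5"
    unfolding cross_set_def card_filter_line by code_simp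
  moreover have "(1, 0, 0) \<in> pts" by (simp add: mem_pts)
  ultimately show "\<exists>l\<in>pts. card (cross_set \<inter> line_set l) = 5" by blast
qed

lemma act_image_Collect:
  assumes "invertible5 M" "\<And>p. p \<in> pts \<Longrightarrow> P p \<longleftrightarrow> Q (act M p)"
  shows "act M ` {p \<in> pts. P p} = {q \<in> pts. Q q}"
proof (intro equalityI subsetI)
  fix q assume "q \<in> act M ` {p \<in> pts. P p}"
  then obtain p where p: "p \<in> pts" "P p" "q = act M p" by blast
  then show "q \<in> {q \<in> pts. Q q}" using assms(2)[OF p(1)] act_in_pts[OF assms(1) p(1)] by simp
next
  fix q assume q: "q \<in> {q \<in> pts. Q q}"
  then obtain p where p: "p \<in> pts" "q = act M p"
    using bij_betw_imp_surj_on[OF bij_betw_act[OF assms(1)]] by blast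
  then have "P p" using q assms(2)[OF p(1)] by simp
  then show "q \<in> act M ` {p \<in> pts. P p}" using p by blast
qed

lemma det3_rows: "det3 (u, v, w) = dot w (cross u v)"
  by (cases u; cases v; cases w) (simp add: algebra_simps)

text \<open>Two distinct lines can be completed to the rows of an invertible matrix, which sends
  them to \<open>x = 0\<close> and \<open>y = 0\<close>.\<close>

lemma trivial_set_cross_set:
  assumes "trivial_set T" shows "T \<subseteq> pts" "proj_equiv T cross_set"
proof -
  obtain l1 l2 where l: "l1 \<in> pts" "l2 \<in> pts" "l1 \<noteq> l2"
    "T = (line_set l1 \<union> line_set l2) - (line_set l1 \<inter> line_set l2)"
    using assms unfolding trivial_set_def by blast
  have T: "T = {p \<in> pts. incident l1 p \<noteq> incident l2 p}"
    unfolding l(4) line_set_def by blast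
  then show "T \<subseteq> pts" by blast
  have "nonzero5 (cross l1 l2)" using pts_eqI l(1-3) by blast
  moreover obtain x y z where xyz: "cross l1 l2 = (x, y, z)" by (cases "cross l1 l2")
  ultimately have "x mod 5 \<noteq> 0 \<or> y mod 5 \<noteq> 0 \<or> z mod 5 \<noteq> 0" by (auto simp: nonzero5_def)
  moreover have "dot (1, 0, 0) (x, y, z) = x" "dot (0, 1, 0) (x, y, z) = y" "dot (0, 0, 1) (x, y, z) = z"
    by simp_all
  \<comment> \<open>A unit vector selecting a nonzero coordinate of the cross product serves as
    third row, since the determinant is then that coordinate.\<close>
  ultimately obtain r where "dot r (cross l1 l2) mod 5 \<noteq> 0" unfolding xyz by metis
  then have M: "invertible5 (l1, l2, r)" unfolding invertible5_def det3_rows .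
  have "act (l1, l2, r) ` T = cross_set" unfolding T cross_set_def
  proof (rule act_image_Collect[OF M])
    fix p assume p: "p \<in> pts"
    have "mulv (transp (l1, l2, r)) (1, 0, 0) = l1" "mulv (transp (l1, l2, r)) (0, 1, 0) = l2"
      by (cases l1; cases l2; cases r; simp)+
    then show "(incident l1 p \<noteq> incident l2 p) \<longleftrightarrow>
        (incident (1, 0, 0) (act (l1, l2, r) p) \<noteq> incident (0, 1, 0) (act (l1, l2, r) p))"
      using incident_act[OF M p] by simp
  qed
  then show "proj_equiv T cross_set" using \<open>T \<subseteq> pts\<close> M proj_equivI by blast
qed

section \<open>Congruence and diagonalisation of quadratic forms over GF(5)\<close>

definition congr :: "mat \<Rightarrow> mat \<Rightarrow> mat" where
  "congr M A = mmul (transp M) (mmul A M)"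

lemma qform_congr: "qform (congr M A) v = qform A (mulv M v)"
proof -
  have "dot x y = dot y x" for x y by (cases x; cases y) simp
  then show ?thesis unfolding qform_def congr_def mulv_mmul dot_mulv transp_transp by metis
qed

lemma det3_congr: "det3 (congr M A) = det3 M * (det3 A * det3 M)"
  by (simp add: congr_def det3_mmul det3_transp)

lemma qform_peq: assumes "peq v w" shows "qform A v mod 5 = 0 \<longleftrightarrow> qform A w mod 5 = 0"
proof -
  obtain k where k: "k mod 5 \<noteq> 0" "cong5 v (smul k w)" using assms unfolding peq_def by blast
  have c: "dot v x mod 5 = dot (smul k w) y mod 5" if "cong5 x y" for x y
    using that k(2) by (cases v; cases w; cases x; cases y) (auto intro!: mod_add_cong mod_mult_cong)
  have "qform A v mod 5 = qform A (smul k w) mod 5"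
    unfolding qform_def by (intro c cong5_mulv k)
  also have "qform A (smul k w) = k * (k * qform A w)"
    unfolding qform_def mulv_smul by (cases w; cases "mulv A w") (simp add: algebra_simps)
  finally show ?thesis using k(1) by (simp only: unit5_mult simp_thms)
qed

lemma conic_congr: assumes "invertible5 M" shows "act M ` conic (congr M A) = conic A"
  unfolding conic_def
proof (rule act_image_Collect[OF assms])
  fix p assume "p \<in> pts"
  show "qform (congr M A) p mod 5 = 0 \<longleftrightarrow> qform A (act M p) mod 5 = 0"
    unfolding qform_congr by (rule qform_peq[OF peq_act[OF assms \<open>p \<in> pts\<close>]])
qed

lemma interior_pts_eq:
  "interior_pts A = {p \<in> pts. qform A p mod 5 \<noteq> 0 \<and>
      (\<forall>l\<in>pts. incident l p \<longrightarrow> card (conic A \<inter> line_set l) \<noteq> 1)}"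
  unfolding interior_pts_def by (auto simp: conic_def)

lemma interior_pts_subset: "interior_pts A \<subseteq> pts"
  unfolding interior_pts_def by blast

text \<open>Interior points are described by the conic, incidence and tangency alone. The map
  \<open>act M\<close> transports the conic, and \<open>act (transp M)\<close> permutes the lines
  while matching their intersection numbers.\<close>

lemma interior_congr:
  assumes M: "invertible5 M" shows "act M ` interior_pts (congr M A) = interior_pts A"
  unfolding interior_pts_eq
proof (rule act_image_Collect[OF M])
  fix p assume p: "p \<in> pts"
  let ?B = "congr M A" and ?t = "act (transp M)"
  have tM: "invertible5 (transp M)" using M invertible5_transp by blast
  have card: "card (conic A \<inter> line_set l) = card (conic ?B \<inter> line_set (?t l))" if "l \<in> pts" for l
    using card_act_line[OF M _ that, of "conic ?B"] conic_congr[OF M, of A] by (simp add: conic_def)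
  have surj: "?t ` pts = pts" by (rule bij_betw_imp_surj_on[OF bij_betw_act[OF tM]])
  have "(\<forall>l\<in>pts. incident l p \<longrightarrow> card (conic ?B \<inter> line_set l) \<noteq> 1) \<longleftrightarrow>
      (\<forall>l\<in>?t ` pts. incident l p \<longrightarrow> card (conic ?B \<inter> line_set l) \<noteq> 1)"
    by (simp only: surj)
  also have "\<dots> \<longleftrightarrow> (\<forall>l\<in>pts. incident l (act M p) \<longrightarrow> card (conic A \<inter> line_set l) \<noteq> 1)"
    using card incident_act_transp[OF M p] by simp
  finally show "(qform ?B p mod 5 \<noteq> 0 \<and>
      (\<forall>l\<in>pts. incident l p \<longrightarrow> card (conic ?B \<inter> line_set l) \<noteq> 1)) \<longleftrightarrow>
    (qform A (act M p) mod 5 \<noteq> 0 \<and>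
      (\<forall>l\<in>pts. incident l (act M p) \<longrightarrow> card (conic A \<inter> line_set l) \<noteq> 1))"
    using qform_peq[OF peq_act[OF M p], of A] by (simp only: qform_congr)
qed

lemma interior_proj_equiv_congr:
  "invertible5 M \<Longrightarrow> proj_equiv (interior_pts A) (interior_pts (congr M A))"
  by (intro proj_equiv_sym[OF proj_equivI[OF _ interior_pts_subset interior_congr]] interior_pts_subset)

lemma interior_pts_cong:
  assumes "\<And>p. qform A p mod 5 = 0 \<longleftrightarrow> qform B p mod 5 = 0"
  shows "interior_pts A = interior_pts B"
  unfolding interior_pts_eq conic_def using assms by simp

definition diag :: "int \<Rightarrow> int \<Rightarrow> int \<Rightarrow> mat" where
  "diag a b c = ((a, 0, 0), (0, b, 0), (0, 0, c))"

text \<open>Multiplying a form by a unit leaves its zero set unchanged, so coefficients matter only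
  modulo 5 and up to a common unit.\<close>

lemma diag_scale:
  assumes "k mod 5 \<noteq> 0" "(k * a) mod 5 = a' mod 5" "(k * b) mod 5 = b' mod 5" "(k * c) mod 5 = c' mod 5"
  shows "interior_pts (diag a b c) = interior_pts (diag a' b' c')"
proof (rule interior_pts_cong)
  fix p :: vec
  obtain x y z where p: "p = (x, y, z)" by (cases p)
  have q: "qform (diag a b c) p = a * (x * x) + b * (y * y) + c * (z * z)" for a b c
    by (simp add: p qform_def diag_def algebra_simps)
  have "qform (diag a' b' c') p mod 5 = (k * a * (x * x) + k * b * (y * y) + k * c * (z * z)) mod 5"
    unfolding q by (intro mod_add_cong mod_mult_cong assms(2-4)[symmetric] refl)
  also have "\<dots> = (k * qform (diag a b c) p) mod 5" unfolding q by (simp add: algebra_simps)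
  finally show "qform (diag a b c) p mod 5 = 0 \<longleftrightarrow> qform (diag a' b' c') p mod 5 = 0"
    using assms(1) by (simp only: unit5_mult simp_thms)
qed

abbreviation interior_equiv :: "mat \<Rightarrow> mat \<Rightarrow> bool" where
  "interior_equiv A B \<equiv> proj_equiv (interior_pts A) (interior_pts B)"

lemma interior_equiv_trans: "interior_equiv A B \<Longrightarrow> interior_equiv B C \<Longrightarrow> interior_equiv A C"
  using proj_equiv_trans interior_pts_subset by blast

lemma interior_equiv_congr:
  "congr M A = B \<Longrightarrow> det3 M mod 5 \<noteq> 0 \<Longrightarrow> interior_equiv A B"
  using interior_proj_equiv_congr unfolding invertible5_def by blast

text \<open>The nonzero squares modulo 5 are 1 and 4, so rescaling the coordinates brings
  \<open>b\<close> and \<open>c\<close> into \<open>{1, 2}\<close>. The remaining forms are treated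
  one by one.\<close>

lemma diag_1_equiv:
  assumes "b mod 5 \<noteq> 0" "c mod 5 \<noteq> 0" shows "interior_equiv (diag 1 b c) (diag 1 1 1)"
proof -
  have norm: "\<exists>u. u mod 5 \<noteq> 0 \<and> (b * (u * u)) mod 5 \<in> {1, 2}" if "b mod 5 \<noteq> 0" for b :: int
  proof -
    have "\<exists>u\<in>{1, 2}. ((b mod 5) * (u * u)) mod 5 \<in> {1, 2}"
      using mod5_cases[of b] that by (elim insertE) simp_all
    then obtain u where "u \<in> {1, 2}" "((b mod 5) * (u * u)) mod 5 \<in> {1, 2}" by blast
    then have "u mod 5 \<noteq> 0" "(b * (u * u)) mod 5 \<in> {1, 2}" by (auto simp: mod_mult_left_eq)
    then show ?thesis by blast
  qed
  obtain u where u: "u mod 5 \<noteq> 0" "(b * (u * u)) mod 5 \<in> {1, 2}" using norm[OF assms(1)] by blast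
  obtain v where v: "v mod 5 \<noteq> 0" "(c * (v * v)) mod 5 \<in> {1, 2}" using norm[OF assms(2)] by blast
  have "congr (diag 1 u v) (diag 1 b c) = diag 1 (b * (u * u)) (c * (v * v))"
    by (simp add: congr_def diag_def algebra_simps)
  moreover have "det3 (diag 1 u v) mod 5 \<noteq> 0"
    using unit5_multI[OF u(1) v(1)] by (simp add: diag_def)
  ultimately have 1: "interior_equiv (diag 1 b c) (diag 1 (b * (u * u)) (c * (v * v)))"
    by (rule interior_equiv_congr)
  have 2: "interior_pts (diag 1 (b * (u * u)) (c * (v * v))) =
    interior_pts (diag 1 ((b * (u * u)) mod 5) ((c * (v * v)) mod 5))"
    by (rule diag_scale[of 1]) simp_all
  \<comment> \<open>Replacing two variables by their sum and difference turns
    \<open>x^2 + y^2\<close> into \<open>2 (x^2 + y^2)\<close>. With an extra factor 2 in the third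
    substitution this yields a form proportional to \<open>diag 1 1 1\<close> modulo 5 in every
    case.\<close>
  have "interior_equiv (diag 1 1 2) (diag 2 2 2)"
    by (rule interior_equiv_congr[of "((1, 1, 0), (1, -1, 0), (0, 0, 1))"]) (simp_all add: congr_def diag_def)
  moreover have "interior_equiv (diag 1 2 1) (diag 2 2 2)"
    by (rule interior_equiv_congr[of "((1, 0, 1), (0, 1, 0), (1, 0, -1))"]) (simp_all add: congr_def diag_def)
  moreover have "interior_equiv (diag 1 2 2) (diag 1 16 16)"
    by (rule interior_equiv_congr[of "((1, 0, 0), (0, 2, 2), (0, 2, -2))"]) (simp_all add: congr_def diag_def)
  moreover have "interior_pts (diag 2 2 2) = interior_pts (diag 1 1 1)"
    by (rule diag_scale[of 3]) simp_all
  moreover have "interior_pts (diag 1 16 16) = interior_pts (diag 1 1 1)"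
    by (rule diag_scale[of 1]) simp_all
  moreover have "interior_equiv (diag 1 1 1) (diag 1 1 1)"
    by (rule proj_equiv_refl[OF interior_pts_subset])
  ultimately have "interior_equiv (diag 1 m n) (diag 1 1 1)" if "m \<in> {1, 2}" "n \<in> {1, 2}" for m n
    using that by (elim insertE emptyE) simp_all
  from this[OF u(2) v(2)] show ?thesis using 1 unfolding 2 by (rule interior_equiv_trans[rotated])
qed

lemma diag_equiv:
  assumes "a mod 5 \<noteq> 0" "b mod 5 \<noteq> 0" "c mod 5 \<noteq> 0"
  shows "interior_equiv (diag a b c) (diag 1 1 1)"
proof -
  obtain k where k: "k mod 5 \<noteq> 0" "(k * a) mod 5 = 1" using unit5_inverse[OF assms(1)] by blast
  have "interior_pts (diag a b c) = interior_pts (diag 1 (k * b) (k * c))"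
    by (rule diag_scale[OF k(1)]) (simp_all add: k(2))
  then show ?thesis using diag_1_equiv[OF unit5_multI[OF k(1) assms(2)] unit5_multI[OF k(1) assms(3)]]
    by simp
qed

text \<open>Completing the square in the lower block, after making one of its diagonal entries a
  unit.\<close>

lemma block_equiv:
  assumes "a mod 5 \<noteq> 0" "(d * f - e * e) mod 5 \<noteq> 0"
  shows "interior_equiv ((a, 0, 0), (0, d, e), (0, e, f)) (diag 1 1 1)"
proof -
  have main: "interior_equiv ((a, 0, 0), (0, d, e), (0, e, f)) (diag 1 1 1)"
    if "d mod 5 \<noteq> 0" "(d * f - e * e) mod 5 \<noteq> 0" for d e f
  proof -
    \<comment> \<open>The substitution \<open>y - e z\<close>, \<open>d z\<close> is the completion
      of the square multiplied through by \<open>d\<close>, which avoids division.\<close>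
    have "congr ((1, 0, 0), (0, 1, -e), (0, 0, d)) ((a, 0, 0), (0, d, e), (0, e, f)) =
      diag a d (d * (d * f - e * e))" by (simp add: congr_def diag_def algebra_simps)
    then have "interior_equiv ((a, 0, 0), (0, d, e), (0, e, f)) (diag a d (d * (d * f - e * e)))"
      by (rule interior_equiv_congr) (use that in simp)
    moreover have "interior_equiv (diag a d (d * (d * f - e * e))) (diag 1 1 1)"
      by (intro diag_equiv assms that unit5_multI)
    ultimately show ?thesis by (rule interior_equiv_trans)
  qed
  consider "d mod 5 \<noteq> 0" | "f mod 5 \<noteq> 0" | "d mod 5 = 0" "f mod 5 = 0" by metis
  then show ?thesis
  proof cases
    case 1 then show ?thesis using main assms(2) by blast
  next
    case 2
    have "congr ((1, 0, 0), (0, 0, 1), (0, 1, 0)) ((a, 0, 0), (0, d, e), (0, e, f)) =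
      ((a, 0, 0), (0, f, e), (0, e, d))" by (simp add: congr_def)
    then have "interior_equiv ((a, 0, 0), (0, d, e), (0, e, f)) ((a, 0, 0), (0, f, e), (0, e, d))"
      by (rule interior_equiv_congr) simp
    moreover have "interior_equiv ((a, 0, 0), (0, f, e), (0, e, d)) (diag 1 1 1)"
      by (rule main) (use 2 assms(2) in \<open>simp_all only: mult.commute[of f d] simp_thms\<close>)
    ultimately show ?thesis by (rule interior_equiv_trans)
  next
    case 3
    \<comment> \<open>The block is a hyperbolic plane modulo 5, so \<open>e\<close> is a unit;
      replacing \<open>z\<close> by \<open>y + z\<close> creates the diagonal entry
      \<open>2 e\<close> modulo 5.\<close>
    have "congr ((1, 0, 0), (0, 1, 0), (0, 1, 1)) ((a, 0, 0), (0, d, e), (0, e, f)) =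
      ((a, 0, 0), (0, d + 2 * e + f, e + f), (0, e + f, f))" by (simp add: congr_def algebra_simps)
    then have "interior_equiv ((a, 0, 0), (0, d, e), (0, e, f))
        ((a, 0, 0), (0, d + 2 * e + f, e + f), (0, e + f, f))"
      by (rule interior_equiv_congr) simp
    moreover have "interior_equiv ((a, 0, 0), (0, d + 2 * e + f, e + f), (0, e + f, f)) (diag 1 1 1)"
    proof (rule main)
      have "(d + 2 * e + f) * f - (e + f) * (e + f) = d * f - e * e" by (simp add: algebra_simps)
      then show "((d + 2 * e + f) * f - (e + f) * (e + f)) mod 5 \<noteq> 0" using assms(2) by simp
      have "e mod 5 \<noteq> 0"
      proof
        assume "e mod 5 = 0"
        then have "5 dvd d * f - e * e" using 3 by auto
        then show False using assms(2) by simp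
      qed
      then show "(d + 2 * e + f) mod 5 \<noteq> 0" using 3 by presburger
    qed
    ultimately show ?thesis by (rule interior_equiv_trans)
  qed
qed

text \<open>Completing the square in the first variable, again without division:
  \<open>x - b y - c z\<close> together with \<open>a y\<close> and \<open>a z\<close> clears the
  rest of the first row and column.\<close>

lemma symmetric_equiv:
  assumes "a mod 5 \<noteq> 0" "det3 ((a, b, c), (b, d, e), (c, e, f)) mod 5 \<noteq> 0"
  shows "interior_equiv ((a, b, c), (b, d, e), (c, e, f)) (diag 1 1 1)"
proof -
  let ?A = "((a, b, c), (b, d, e), (c, e, f))" and ?M = "((1, -b, -c), (0, a, 0), (0, 0, a))"
  let ?B = "((a, 0, 0), (0, a * (a * d - b * b), a * (a * e - b * c)),
       (0, a * (a * e - b * c), a * (a * f - c * c)))"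
  have M: "det3 ?M mod 5 \<noteq> 0" using unit5_multI[OF assms(1) assms(1)] by simp
  have AB: "congr ?M ?A = ?B" by (simp add: congr_def algebra_simps)
  then have "interior_equiv ?A ?B" using M by (rule interior_equiv_congr)
  moreover have "interior_equiv ?B (diag 1 1 1)"
  proof (rule block_equiv[OF assms(1)])
    have "det3 ?B mod 5 \<noteq> 0"
      unfolding AB[symmetric] det3_congr by (intro unit5_multI M assms)
    moreover have "det3 ?B = a * (a * (a * d - b * b) * (a * (a * f - c * c)) -
      a * (a * e - b * c) * (a * (a * e - b * c)))" by simp
    ultimately show "(a * (a * d - b * b) * (a * (a * f - c * c)) -
      a * (a * e - b * c) * (a * (a * e - b * c))) mod 5 \<noteq> 0"
      by (simp only: unit5_mult simp_thms de_Morgan_disj)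
  qed
  ultimately show ?thesis by (rule interior_equiv_trans)
qed

text \<open>A permutation of coordinates, or adding one coordinate to another, makes the upper left
  entry a unit. If neither applies, the first row vanishes modulo 5 and so does the
  determinant.\<close>

lemma irreducible_conic_equiv:
  assumes "irreducible_conic_matrix A" shows "interior_equiv A (diag 1 1 1)"
proof -
  obtain a b c d e f where A: "A = ((a, b, c), (b, d, e), (c, e, f))"
  proof (rule mat_cases[of A])
    fix a b c b' d e c' e' f assume A: "A = ((a, b, c), (b', d, e), (c', e', f))"
    have "transp A = A" using assms unfolding irreducible_conic_matrix_def by blast
    then have "b' = b" "c' = c" "e' = e" unfolding A transp.simps prod.inject by blast+
    then have "A = ((a, b, c), (b, d, e), (c, e, f))" unfolding A by simp
    then show thesis by (rule that)
  qed
  have det: "det3 A mod 5 \<noteq> 0" using assms unfolding irreducible_conic_matrix_def by (rule conjunct2)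
  have step: ?thesis
    if "congr M A = ((a', b', c'), (b', d', e'), (c', e', f'))" "det3 M mod 5 \<noteq> 0" "a' mod 5 \<noteq> 0"
    for M a' b' c' d' e' f'
  proof -
    have "det3 (congr M A) mod 5 \<noteq> 0"
      unfolding det3_congr by (intro unit5_multI that det)
    then have "interior_equiv (congr M A) (diag 1 1 1)"
      unfolding that(1) by (rule symmetric_equiv[OF that(3)])
    then show ?thesis by (rule interior_equiv_trans[OF interior_equiv_congr[OF refl that(2)]])
  qed
  consider "a mod 5 \<noteq> 0" | "d mod 5 \<noteq> 0" | "f mod 5 \<noteq> 0"
    | "a mod 5 = 0" "d mod 5 = 0" "b mod 5 \<noteq> 0" | "a mod 5 = 0" "f mod 5 = 0" "c mod 5 \<noteq> 0"
    | "a mod 5 = 0" "b mod 5 = 0" "c mod 5 = 0" by metis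
  then show ?thesis
  proof cases
    case 1 then show ?thesis using det unfolding A by (rule symmetric_equiv)
  next
    case 2
    show ?thesis
      by (rule step[of "((0, 1, 0), (1, 0, 0), (0, 0, 1))" d b e a c f]) (use 2 in \<open>simp_all add: A congr_def\<close>)
  next
    case 3
    show ?thesis
      by (rule step[of "((0, 0, 1), (0, 1, 0), (1, 0, 0))" f e c d b a]) (use 3 in \<open>simp_all add: A congr_def\<close>)
  next
    case 4
    then have "(a + 2 * b + d) mod 5 \<noteq> 0" by presburger
    then show ?thesis
      by (intro step[of "((1, 0, 0), (1, 1, 0), (0, 0, 1))" "a + 2 * b + d" "b + d" "c + e" d e f])
        (simp_all add: A congr_def)
  next
    case 5
    then have "(a + 2 * c + f) mod 5 \<noteq> 0" by presburger
    then show ?thesis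
      by (intro step[of "((1, 0, 0), (0, 1, 0), (1, 0, 1))" "a + 2 * c + f" "b + e" "c + f" d e f])
        (simp_all add: A congr_def)
  next
    case 6
    then have "5 dvd det3 A" by (auto simp: A)
    then show ?thesis using det by simp
  qed
qed

section \<open>Evaluating the interior of the reference conic\<close>

definition interior_list :: "mat \<Rightarrow> vec list" where
  "interior_list A =
    (let C = filter (\<lambda>p. qform A p mod 5 = 0) point_list;
         T = filter (\<lambda>l. length (filter (incident l) C) = 1) point_list
     in filter (\<lambda>p. qform A p mod 5 \<noteq> 0 \<and> list_all (\<lambda>l. \<not> incident l p) T) point_list)"

lemma set_interior_list: "set (interior_list A) = interior_pts A"
proof -
  have "card (conic A \<inter> line_set l) =
      length (filter (incident l) (filter (\<lambda>p. qform A p mod 5 = 0) point_list))" for l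
    unfolding conic_def card_filter_line filter_filter ..
  then show ?thesis
    unfolding interior_pts_eq interior_list_def Let_def
    by (auto simp: pts_eq_set_point_list list_all_iff)
qed

text \<open>Evaluation shows that lines meet this set in 0, 2 or 3 points only, which excludes
  tangents and 5-secants at once.\<close>

lemma interior_diag_properties:
  "tangent_free (interior_pts (diag 1 1 1))" "card (interior_pts (diag 1 1 1)) = 10"
  "\<not> (\<exists>l\<in>pts. card (interior_pts (diag 1 1 1) \<inter> line_set l) = 5)"
proof -
  let ?L = "interior_list (diag 1 1 1)"
  have d: "distinct ?L" unfolding interior_list_def Let_def by (intro distinct_filter distinct_point_list)
  have card: "card (interior_pts (diag 1 1 1) \<inter> line_set l) = length (filter (incident l) ?L)" for l
  proof -
    have "interior_pts (diag 1 1 1) \<inter> line_set l = set (filter (incident l) ?L)"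
      using interior_pts_subset unfolding set_filter set_interior_list line_set_def by blast
    then show ?thesis using distinct_card[OF distinct_filter[OF d]] by simp
  qed
  have "list_all (\<lambda>l. length (filter (incident l) ?L) \<in> {0, 2, 3}) point_list" by code_simp
  then have v: "card (interior_pts (diag 1 1 1) \<inter> line_set l) \<in> {0, 2, 3}" if "l \<in> pts" for l
    using that unfolding card list_all_iff pts_eq_set_point_list[symmetric] by blast
  have no: "card (interior_pts (diag 1 1 1) \<inter> line_set l) \<noteq> k" if "l \<in> pts" "k \<notin> {0, 2, 3}" for l k
    using v[OF that(1)] that(2) by blast
  show "tangent_free (interior_pts (diag 1 1 1))"
    unfolding tangent_free_def using interior_pts_subset no[of _ 1] by simp
  show "\<not> (\<exists>l\<in>pts. card (interior_pts (diag 1 1 1) \<inter> line_set l) = 5)"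
    using no[of _ 5] by simp
  have "length ?L = 10" by code_simp
  then show "card (interior_pts (diag 1 1 1)) = 10"
    using distinct_card[OF d] by (simp add: set_interior_list)
qed

section \<open>Counting secants\<close>

lemma nonzero5_cross: "p \<in> pts \<Longrightarrow> q \<in> pts \<Longrightarrow> p \<noteq> q \<Longrightarrow> nonzero5 (cross p q)"
  using pts_eqI by blast

lemma parallel_imp_canon:
  assumes "p \<in> pts" "nonzero5 w" "\<not> nonzero5 (cross p w)" shows "p = canon w"
proof -
  \<comment> \<open>The skew-symmetric matrix of \<open>cross p\<close>, so that compatibility of
    \<open>peq\<close> with matrices applies to the cross product.\<close>
  define M :: mat where "M = (let (a, b, c) = p in ((0, -c, b), (c, 0, -a), (-b, a, 0)))"
  have M: "mulv M v = cross p v" for v by (cases p; cases v) (simp add: M_def)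
  have "peq (cross p w) (cross p (canon w))"
    using peq_mulv[OF canon(2)[OF assms(2)], of M] by (simp only: M)
  then have "\<not> nonzero5 (cross p (canon w))" using assms(3) nonzero5_peq by blast
  then show ?thesis using pts_eqI assms(1) canon(1)[OF assms(2)] by blast
qed

text \<open>The triple product identity: \<open>p x (l x m)\<close> equals
  \<open>(p . m) l - (p . l) m\<close>.\<close>

lemma orthogonal_cross:
  assumes "incident l p" "incident m p" shows "\<not> nonzero5 (cross p (cross l m))"
proof -
  obtain a b c where l: "l = (a, b, c)" by (cases l)
  obtain d e f where m: "m = (d, e, f)" by (cases m)
  obtain x y z where p: "p = (x, y, z)" by (cases p)
  have "5 dvd dot l p" "5 dvd dot m p" using assms by (auto simp: incident_def)
  then have "5 dvd dot m p * t - dot l p * u" for t u by (intro dvd_diff dvd_mult2)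
  from this[of a d] this[of b e] this[of c f]
  show ?thesis unfolding nonzero5_def l m p
    by (simp add: algebra_simps dvd_eq_mod_eq_0)
qed

text \<open>Distinct lines share only the point \<open>canon (cross l m)\<close>, to which both
  \<open>p\<close> and \<open>q\<close> would be equal.\<close>

lemma line_unique:
  assumes "p \<in> pts" "q \<in> pts" "p \<noteq> q" "l \<in> pts" "m \<in> pts"
    and "incident l p" "incident l q" "incident m p" "incident m q"
  shows "l = m"
proof (rule ccontr)
  assume "l \<noteq> m"
  then have w: "nonzero5 (cross l m)" using assms nonzero5_cross by blast
  have "p = canon (cross l m)" by (intro parallel_imp_canon w orthogonal_cross assms)
  moreover have "q = canon (cross l m)" by (intro parallel_imp_canon w orthogonal_cross assms)
  ultimately show False using assms(3) by simp
qed

lemma incident_cross: "incident (cross p q) p" "incident (cross p q) q"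
  by (cases p; cases q; simp add: incident_def algebra_simps)+

lemma ex_line:
  assumes "p \<in> pts" "q \<in> pts" "p \<noteq> q"
  obtains l where "l \<in> pts" "incident l p" "incident l q"
proof
  have w: "nonzero5 (cross p q)" using assms nonzero5_cross by blast
  show "canon (cross p q) \<in> pts" using canon(1)[OF w] .
  show "incident (canon (cross p q)) p" "incident (canon (cross p q)) q"
    using incident_peq(2)[OF canon(2)[OF w]] incident_cross by blast+
qed

lemma ex_meet:
  assumes "l \<in> pts" "m \<in> pts" "l \<noteq> m"
  obtains p where "p \<in> pts" "incident l p" "incident m p"
proof (rule ex_line[OF assms])
  fix p assume "p \<in> pts" "incident p l" "incident p m"
  then show thesis using that incident_sym[of p l] incident_sym[of p m] by blast
qed

lemma card_line_set: assumes "l \<in> pts" shows "card (line_set l) = 6"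
  using card_lines_through[OF assms] unfolding line_set_def incident_sym[of l] .

lemma finite_line_set: "finite (line_set l)"
  unfolding line_set_def using finite_pts by simp

text \<open>The lines through \<open>p\<close> partition the other points of the plane, hence they
  partition \<open>S\<close>.\<close>

lemma sum_card_lines_through:
  assumes "S \<subseteq> pts" "p \<in> pts" "p \<notin> S"
  shows "(\<Sum>l | l \<in> pts \<and> incident l p. card (S \<inter> line_set l)) = card S"
proof -
  let ?L = "{l. l \<in> pts \<and> incident l p}"
  have fin: "finite S" "finite ?L" using assms(1) finite_pts finite_subset by auto
  have "S = (\<Union>l\<in>?L. S \<inter> line_set l)"
  proof (intro equalityI subsetI)
    fix q assume q: "q \<in> S"
    then have "q \<in> pts" "p \<noteq> q" using assms by blast+
    then obtain l where "l \<in> pts" "incident l p" "incident l q" using ex_line assms(2) by blast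
    then show "q \<in> (\<Union>l\<in>?L. S \<inter> line_set l)" using q \<open>q \<in> pts\<close> unfolding line_set_def by blast
  qed blast
  moreover have "(S \<inter> line_set l) \<inter> (S \<inter> line_set m) = {}" if "l \<in> ?L" "m \<in> ?L" "l \<noteq> m" for l m
  proof (rule ccontr)
    assume "(S \<inter> line_set l) \<inter> (S \<inter> line_set m) \<noteq> {}"
    then obtain q where q: "q \<in> S" "q \<in> pts" "incident l q" "incident m q"
      unfolding line_set_def by blast
    then have "p \<noteq> q" using assms(3) by blast
    then have "l = m" using line_unique[OF assms(2) q(2)] that q by blast
    then show False using that by blast
  qed
  ultimately show ?thesis
    using card_UN_disjoint[OF fin(2), of "\<lambda>l. S \<inter> line_set l"] fin(1) by simp
qed

text \<open>The point \<open>p\<close> is counted on all six lines instead of once, which adds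
  5.\<close>

lemma sum_card_lines_through_member:
  assumes "S \<subseteq> pts" "p \<in> S"
  shows "(\<Sum>l | l \<in> pts \<and> incident l p. card (S \<inter> line_set l)) = card S + 5"
proof -
  let ?L = "{l. l \<in> pts \<and> incident l p}"
  have p: "p \<in> pts" using assms by blast
  have fin: "finite S" using assms(1) finite_pts finite_subset by auto
  have *: "card (S \<inter> line_set l) = card ((S - {p}) \<inter> line_set l) + 1" if "l \<in> ?L" for l
  proof -
    have "S \<inter> line_set l = insert p ((S - {p}) \<inter> line_set l)"
      using that assms p unfolding line_set_def by blast
    then show ?thesis using fin by simp
  qed
  have "(\<Sum>l\<in>?L. card (S \<inter> line_set l)) = (\<Sum>l\<in>?L. card ((S - {p}) \<inter> line_set l) + 1)"
    using * by (intro sum.cong refl) blast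
  also have "\<dots> = (\<Sum>l\<in>?L. card ((S - {p}) \<inter> line_set l)) + card ?L"
    by (simp only: sum.distrib card_eq_sum)
  also have "(\<Sum>l\<in>?L. card ((S - {p}) \<inter> line_set l)) = card (S - {p})"
    by (rule sum_card_lines_through) (use assms p in auto)
  also have "card ?L = 6" by (rule card_lines_through[OF p])
  also have "card (S - {p}) + 6 = card S + 5"
    using fin assms(2) card_Suc_Diff1[of S p] by simp
  finally show ?thesis .
qed

text \<open>Supplies the counting equations for intersection numbers when tangents and lines with
  five or more points are excluded.\<close>

lemma value_counts:
  fixes f :: "'a \<Rightarrow> nat"
  assumes "finite X" "\<And>x. x \<in> X \<Longrightarrow> f x \<in> {0, 2, 3, 4}"
  shows "card X = card {x \<in> X. f x = 0} + card {x \<in> X. f x = 2} + card {x \<in> X. f x = 3} + card {x \<in> X. f x = 4}"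
    and "sum f X = 2 * card {x \<in> X. f x = 2} + 3 * card {x \<in> X. f x = 3} + 4 * card {x \<in> X. f x = 4}"
proof -
  have c: "card {x \<in> X. f x = k} = (\<Sum>x\<in>X. if f x = k then 1 else 0)" for k
    using assms(1) by (simp add: sum.If_cases Int_def)
  have "card X = (\<Sum>x\<in>X. (if f x = 0 then 1 else 0) + (if f x = 2 then 1 else 0) +
    (if f x = 3 then 1 else 0) + (if f x = 4 then 1 else 0))"
    unfolding card_eq_sum using assms(2) by (intro sum.cong refl) force
  then show "card X = card {x \<in> X. f x = 0} + card {x \<in> X. f x = 2} + card {x \<in> X. f x = 3} + card {x \<in> X. f x = 4}"
    by (simp only: c sum.distrib)
  have "sum f X = (\<Sum>x\<in>X. 2 * (if f x = 2 then 1 else 0) +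
    3 * (if f x = 3 then 1 else 0) + 4 * (if f x = 4 then 1 else 0))"
    using assms(2) by (intro sum.cong refl) force
  then show "sum f X = 2 * card {x \<in> X. f x = 2} + 3 * card {x \<in> X. f x = 3} + 4 * card {x \<in> X. f x = 4}"
    by (simp only: c sum.distrib sum_distrib_left)
qed

lemma tangent_free_5_secant_trivial:
  assumes S: "tangent_free S" "card S = 10" and l: "l \<in> pts" "card (S \<inter> line_set l) \<ge> 5"
  shows "trivial_set S"
proof -
  have Sp: "S \<subseteq> pts" using S(1) unfolding tangent_free_def by blast
  then have finS: "finite S" using finite_pts finite_subset by blast
  let ?n = "\<lambda>l. card (S \<inter> line_set l)"
  \<comment> \<open>The six intersection numbers at \<open>p\<close> sum to 15 and each is at least
    2; the four lines other than \<open>l\<close> and \<open>m\<close> use up at least 8.\<close>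
  have pencil: "?n l + ?n m \<le> 7" "?n m \<ge> 2"
    if "p \<in> S" "incident l p" "m \<in> pts" "incident m p" "m \<noteq> l" for p m
  proof -
    let ?L = "{l. l \<in> pts \<and> incident l p}"
    have p: "p \<in> pts" using that Sp by blast
    have n2: "?n k \<ge> 2" if k: "k \<in> ?L" for k
    proof -
      have "p \<in> S \<inter> line_set k" using k p \<open>p \<in> S\<close> unfolding line_set_def by blast
      then have "?n k \<noteq> 0" using finS by auto
      moreover have "?n k \<noteq> 1" using S(1) k unfolding tangent_free_def by blast
      ultimately show ?thesis by linarith
    qed
    have finL: "finite ?L" using finite_pts by simp
    have mem: "l \<in> ?L" "m \<in> ?L" using that l by blast+
    then show "?n m \<ge> 2" using n2 by blast
    have "m \<in> ?L - {l}" using mem that(5) by blast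
    then have card4: "card (?L - {l} - {m}) = 4"
      using card_lines_through[OF p] mem(1) by (simp add: card_Diff_singleton)
    have "sum ?n ?L = 15" using sum_card_lines_through_member[OF Sp that(1)] S(2) by simp
    moreover have "sum ?n ?L = ?n l + sum ?n (?L - {l})" by (rule sum.remove[OF finL mem(1)])
    moreover have "sum ?n (?L - {l}) = ?n m + sum ?n (?L - {l} - {m})"
      by (rule sum.remove) (use finL mem that in auto)
    moreover have "(\<Sum>k\<in>?L - {l} - {m}. 2) \<le> sum ?n (?L - {l} - {m})"
      using n2 by (intro sum_mono) blast
    moreover have "(\<Sum>k\<in>?L - {l} - {m}. (2 :: nat)) = 8" by (simp only: sum_constant card4) simp
    ultimately show "?n l + ?n m \<le> 7" by linarith
  qed
  have n5: "?n l = 5"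
  proof -
    have "S \<inter> line_set l \<noteq> {}" using l(2) by (intro notI) simp
    then obtain p where p: "p \<in> S" "p \<in> pts" "incident l p" unfolding line_set_def by blast
    have "card {m \<in> pts. incident m p} = 6" by (rule card_lines_through[OF p(2)])
    then have "\<not> {m \<in> pts. incident m p} \<subseteq> {l}" using card_mono[of "{l}" "{m \<in> pts. incident m p}"] by auto
    then obtain m where "m \<in> pts" "incident m p" "m \<noteq> l" by blast
    from pencil[OF p(1,3) this] show ?thesis using l(2) by linarith
  qed
  have 2: "?n m = 2" if "p \<in> S" "incident l p" "m \<in> pts" "incident m p" "m \<noteq> l" for p m
    using pencil[OF that] n5 by linarith
  have "card (line_set l - S) = 1"
    using card_Diff_subset_Int[of "line_set l" S] finite_line_set card_line_set[OF l(1)] n5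
    by (simp add: Int_commute)
  \<comment> \<open>The one point of \<open>l\<close> outside \<open>S\<close>, where the second
    line will have to meet \<open>l\<close>.\<close>
  then obtain N where N: "line_set l - S = {N}" using card_1_singletonE by blast
  then have Np: "N \<in> pts" "incident l N" "N \<notin> S" unfolding line_set_def by blast+
  define R where "R = S - line_set l"
  have "card R = 5" unfolding R_def using card_Diff_subset_Int[of S "line_set l"] finS S(2) n5 by simp
  then have "R \<noteq> {}" by (intro notI) simp
  then obtain r where r: "r \<in> R" by blast
  then have rp: "r \<in> pts" "r \<in> S" "\<not> incident l r" unfolding R_def line_set_def using Sp by blast+
  then have "r \<noteq> N" using Np by blast
  then obtain m where m: "m \<in> pts" "incident m r" "incident m N" using ex_line rp(1) Np(1) by blast
  have ml: "m \<noteq> l" using m rp by blast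
  have "R \<subseteq> line_set m"
  proof
    fix q assume q: "q \<in> R"
    then have qp: "q \<in> pts" "q \<in> S" "\<not> incident l q" unfolding R_def line_set_def using Sp by blast+
    show "q \<in> line_set m"
    proof (cases "q = r")
      case True then show ?thesis using m rp unfolding line_set_def by blast
    next
      case False
      then obtain k where k: "k \<in> pts" "incident k q" "incident k r" using ex_line qp rp by blast
      then have kl: "k \<noteq> l" using qp by blast
      obtain X where X: "X \<in> pts" "incident k X" "incident l X" using ex_meet k(1) l(1) kl by blast
      \<comment> \<open>A join of two points of \<open>R\<close> cannot meet \<open>l\<close> inside
        \<open>S\<close>: it would be a 2-secant containing three points of \<open>S\<close>. So
        every such join passes through \<open>N\<close>.\<close>
      have "X \<notin> S"
      proof
        assume "X \<in> S"
        then have "?n k = 2" using 2 X k kl by blast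
        moreover have "{X, q, r} \<subseteq> S \<inter> line_set k"
          using \<open>X \<in> S\<close> X k qp rp unfolding line_set_def by blast
        moreover have "X \<noteq> q" "X \<noteq> r" using X qp rp by blast+
        then have "card {X, q, r} = 3" using False by simp
        ultimately show False using card_mono[of "S \<inter> line_set k" "{X, q, r}"] finS by simp
      qed
      then have "X = N" using N X unfolding line_set_def by blast
      then have "k = m" using line_unique[OF rp(1) Np(1) \<open>r \<noteq> N\<close> k(1) m(1)] k m X by blast
      then show ?thesis using k qp unfolding line_set_def by blast
    qed
  qed
  then have "R \<subseteq> line_set m - {N}" using Np unfolding R_def by blast
  moreover have "card (line_set m - {N}) = 5"
    using card_line_set[OF m(1)] m(3) Np(1) finite_line_set by (simp add: line_set_def)
  ultimately have R: "R = line_set m - {N}"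
    using card_subset_eq[of "line_set m - {N}" R] finite_line_set \<open>card R = 5\<close> by simp
  have "line_set l \<inter> line_set m = {N}"
    using R Np m unfolding R_def line_set_def by blast
  moreover have "S = (line_set l - {N}) \<union> (line_set m - {N})"
    using R N unfolding R_def by blast
  ultimately have "S = (line_set l \<union> line_set m) - (line_set l \<inter> line_set m)" by blast
  then show ?thesis unfolding trivial_set_def using l(1) m(1) ml by metis
qed

definition external_lines :: "vec set \<Rightarrow> vec set" where
  "external_lines S = {l \<in> pts. S \<inter> line_set l = {}}"

text \<open>Everything follows from counting the \<open>k\<close>-secants through each point,
  \<open>t k p\<close>, and in the whole plane, \<open>T k\<close>. The conclusions say that the
  external lines form a dual 6-arc whose uncovered points are exactly \<open>S\<close>.\<close>

lemma external_lines_dual_oval: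
  assumes S: "tangent_free S" "card S = 10"
    and no5: "\<forall>l\<in>pts. card (S \<inter> line_set l) < 5"
  shows "card (external_lines S) = 6"
    and "S = {p \<in> pts. \<forall>l\<in>external_lines S. \<not> incident l p}"
    and "\<forall>p\<in>pts. card {l \<in> external_lines S. incident l p} \<le> 2"
proof -
  have Sp: "S \<subseteq> pts" using S(1) unfolding tangent_free_def by blast
  then have finS: "finite S" using finite_pts finite_subset by blast
  let ?n = "\<lambda>l. card (S \<inter> line_set l)"
  let ?L = "\<lambda>p. {l. l \<in> pts \<and> incident l p}"
  define t where "t k p = card {l \<in> ?L p. ?n l = k}" for k p
  define T where "T k = card {l \<in> pts. ?n l = k}" for k
  have val: "?n l \<in> {0, 2, 3, 4}" if "l \<in> pts" for l
  proof -
    have "?n l \<noteq> 1" using S(1) that unfolding tangent_free_def by blast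
    with no5[THEN bspec, OF that] show ?thesis by auto
  qed
  have local: "t 0 p + t 2 p + t 3 p + t 4 p = 6" "sum ?n (?L p) = 2 * t 2 p + 3 * t 3 p + 4 * t 4 p"
    if "p \<in> pts" for p
    using value_counts[of "?L p" ?n] val finite_pts card_lines_through[OF that]
    unfolding t_def by (simp_all)
  have ext: "{l \<in> pts. ?n l = 0} = external_lines S"
    unfolding external_lines_def using finS by (simp add: card_eq_0_iff)
  have t0: "t 0 p = card {l \<in> external_lines S. incident l p}" for p
    unfolding t_def ext[symmetric] by (rule arg_cong[where f = card]) blast
  have T0: "T 0 = card (external_lines S)" unfolding T_def ext ..
  have double: "(\<Sum>p\<in>S. t k p) = k * T k" for k
  proof -
    have "(\<Sum>p\<in>S. card {l \<in> {l \<in> pts. ?n l = k}. incident l p}) = k * card {l \<in> pts. ?n l = k}"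
    proof (rule sum_multicount)
      show "\<forall>l\<in>{l \<in> pts. ?n l = k}. card {p \<in> S. incident l p} = k"
      proof
        fix l assume "l \<in> {l \<in> pts. ?n l = k}"
        moreover have "{p \<in> S. incident l p} = S \<inter> line_set l" using Sp unfolding line_set_def by blast
        ultimately show "card {p \<in> S. incident l p} = k" by simp
      qed
    qed (use finS finite_pts in auto)
    moreover have "{l \<in> {l \<in> pts. ?n l = k}. incident l p} = {l \<in> ?L p. ?n l = k}" for p by blast
    ultimately show ?thesis unfolding t_def T_def by simp
  qed
  have S0: "t 0 p = 0" if "p \<in> S" for p
  proof -
    have "{l \<in> ?L p. ?n l = 0} = {}" using that Sp finS unfolding line_set_def by auto
    then show ?thesis unfolding t_def by (simp only: card.empty)
  qed
  \<comment> \<open>At a point of \<open>S\<close> the six lines satisfy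
    \<open>t 2 + t 3 + t 4 = 6\<close> and \<open>2 t 2 + 3 t 3 + 4 t 4 = 15\<close>; all secant
    numbers are expressed through \<open>t 4\<close>.\<close>
  have S24: "t 3 p + 2 * t 4 p = 3" "t 2 p = 3 + t 4 p" if "p \<in> S" for p
  proof -
    have "p \<in> pts" using that Sp by blast
    note l = local[OF this]
    have "sum ?n (?L p) = 15" using sum_card_lines_through_member[OF Sp that] S(2) by simp
    then show "t 3 p + 2 * t 4 p = 3" "t 2 p = 3 + t 4 p" using l S0[OF that] by linarith+
  qed
  have "(\<Sum>p\<in>S. t 3 p + 2 * t 4 p) = 30" "(\<Sum>p\<in>S. t 2 p) = (\<Sum>p\<in>S. 3 + t 4 p)"
    using S24 S(2) by simp_all
  then have eqs: "3 * T 3 + 8 * T 4 = 30" "2 * T 2 = 30 + 4 * T 4"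
    using double[of 2] double[of 3] double[of 4] S(2)
    by (simp_all add: sum.distrib sum_distrib_left[symmetric])
  \<comment> \<open>Each point of \<open>S\<close> lies on at most one 4-secant, so there are at
    most two of them; divisibility by 3 in \<open>3 T 3 + 8 T 4 = 30\<close> leaves none.\<close>
  have "(\<Sum>p\<in>S. t 4 p) \<le> (\<Sum>p\<in>S. 1)" using S24(1) by (intro sum_mono) fastforce
  then have "4 * T 4 \<le> 10" using double[of 4] S(2) by simp
  then consider "T 4 = 0" | "T 4 = 1" | "T 4 = 2" by linarith
  then have T4: "T 4 = 0"
  proof cases
    case 2
    with eqs have "3 * T 3 = 22" by simp
    then show ?thesis by presburger
  next
    case 3
    with eqs have "3 * T 3 = 14" by simp
    then show ?thesis by presburger
  qed
  with eqs have T23: "T 3 = 10" "T 2 = 15" by simp_all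
  have "card pts = T 0 + T 2 + T 3 + T 4"
    unfolding T_def by (rule value_counts(1)) (use finite_pts val in auto)
  then show "card (external_lines S) = 6" using T4 T23 T0 card_pts by simp
  have t4: "t 4 p = 0" for p
  proof -
    have "{l \<in> pts. ?n l = 4} = {}" using T4 finite_pts unfolding T_def by simp
    then have "{l \<in> ?L p. ?n l = 4} = {}" by blast
    then show ?thesis unfolding t_def by (simp only: card.empty)
  qed
  \<comment> \<open>Off \<open>S\<close> the equation \<open>2 t 2 + 3 t 3 = 10\<close> makes
    \<open>t 3\<close> even, so \<open>t 3\<close> is 0 or 2, giving one or two external lines
    respectively.\<close>
  have out: "t 0 p \<in> {1, 2}" if "p \<in> pts" "p \<notin> S" for p
  proof -
    have "sum ?n (?L p) = 10" using sum_card_lines_through[OF Sp that] S(2) by simp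
    then have "t 0 p + t 2 p + t 3 p = 6" "2 * t 2 p + 3 * t 3 p = 10"
      using local[OF that(1)] t4 by simp_all
    moreover from this(2) consider "t 3 p = 0" | "t 3 p = 1" | "t 3 p = 2" | "t 3 p = 3" by linarith
    ultimately show ?thesis by cases (simp_all, presburger+)
  qed
  show "\<forall>p\<in>pts. card {l \<in> external_lines S. incident l p} \<le> 2"
  proof
    fix p assume "p \<in> pts"
    then show "card {l \<in> external_lines S. incident l p} \<le> 2"
      using S0[of p] out[of p] unfolding t0[symmetric] by (cases "p \<in> S") auto
  qed
  have "finite (external_lines S)" unfolding external_lines_def using finite_pts by simp
  then have "t 0 p = 0 \<longleftrightarrow> (\<forall>l\<in>external_lines S. \<not> incident l p)" for p
    unfolding t0 by auto
  moreover have "p \<in> S \<longleftrightarrow> p \<in> pts \<and> t 0 p = 0" for p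
    using S0[of p] out[of p] Sp by (cases "p \<in> S") auto
  ultimately show "S = {p \<in> pts. \<forall>l\<in>external_lines S. \<not> incident l p}" by blast
qed

section \<open>Moving the external lines to a frame\<close>

text \<open>Three lines with vanishing determinant would be concurrent at
  \<open>canon (cross l1 l2)\<close>.\<close>

lemma dual_arc_det3:
  assumes E: "E \<subseteq> pts" "\<forall>p\<in>pts. card {l \<in> E. incident l p} \<le> 2"
    and l: "l1 \<in> E" "l2 \<in> E" "l3 \<in> E" "l1 \<noteq> l2" "l1 \<noteq> l3" "l2 \<noteq> l3"
  shows "det3 (l1, l2, l3) mod 5 \<noteq> 0"
proof
  assume "det3 (l1, l2, l3) mod 5 = 0"
  then have 3: "incident l3 (cross l1 l2)" unfolding incident_def det3_rows .
  have 12: "incident l1 (cross l1 l2)" "incident l2 (cross l1 l2)"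
    using incident_cross[of l1 l2] incident_sym[of l1] incident_sym[of l2] by simp_all
  have w: "nonzero5 (cross l1 l2)" using l E(1) nonzero5_cross by blast
  define p where "p = canon (cross l1 l2)"
  have p: "p \<in> pts" unfolding p_def by (rule canon(1)[OF w])
  have "incident l p" if "incident l (cross l1 l2)" for l
    using that incident_peq(1)[OF canon(2)[OF w]] unfolding p_def by blast
  then have "{l1, l2, l3} \<subseteq> {l \<in> E. incident l p}" using 12 3 l by blast
  moreover have "finite {l \<in> E. incident l p}" using E(1) finite_pts finite_subset by fastforce
  moreover have "card {l1, l2, l3} = 3" using l by simp
  ultimately have "3 \<le> card {l \<in> E. incident l p}"
    using card_mono[of "{l \<in> E. incident l p}" "{l1, l2, l3}"] by simp
  then show False using E(2)[THEN bspec, OF p] by linarith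
qed

text \<open>The rows of \<open>M\<close> are \<open>l1\<close>, \<open>l2\<close>,
  \<open>l3\<close>, scaled by the coefficients of \<open>l4\<close> in this basis after clearing
  the denominator \<open>det3 (l1, l2, l3)\<close>; their sum is then a unit multiple of
  \<open>l4\<close>.\<close>

lemma frame_map:
  assumes "det3 (l1, l2, l3) mod 5 \<noteq> 0" "det3 (l4, l2, l3) mod 5 \<noteq> 0"
    "det3 (l1, l4, l3) mod 5 \<noteq> 0" "det3 (l1, l2, l4) mod 5 \<noteq> 0"
  obtains M where "invertible5 M"
    "\<And>p. p \<in> pts \<Longrightarrow> incident (1, 0, 0) (act M p) \<longleftrightarrow> incident l1 p"
    "\<And>p. p \<in> pts \<Longrightarrow> incident (0, 1, 0) (act M p) \<longleftrightarrow> incident l2 p"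
    "\<And>p. p \<in> pts \<Longrightarrow> incident (0, 0, 1) (act M p) \<longleftrightarrow> incident l3 p"
    "\<And>p. p \<in> pts \<Longrightarrow> incident (1, 1, 1) (act M p) \<longleftrightarrow> incident l4 p"
proof -
  define c1 c2 c3 where "c1 = det3 (l4, l2, l3)" and "c2 = det3 (l1, l4, l3)" and "c3 = det3 (l1, l2, l4)"
  note c_defs = c1_def c2_def c3_def
  have c: "c1 mod 5 \<noteq> 0" "c2 mod 5 \<noteq> 0" "c3 mod 5 \<noteq> 0" unfolding c_defs by (rule assms)+
  define M where "M = (smul c1 l1, smul c2 l2, smul c3 l3)"
  obtain x1 y1 z1 where l1: "l1 = (x1, y1, z1)" by (cases l1)
  obtain x2 y2 z2 where l2: "l2 = (x2, y2, z2)" by (cases l2)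
  obtain x3 y3 z3 where l3: "l3 = (x3, y3, z3)" by (cases l3)
  obtain x4 y4 z4 where l4: "l4 = (x4, y4, z4)" by (cases l4)
  have "det3 M = c1 * (c2 * (c3 * det3 (l1, l2, l3)))"
    unfolding M_def l1 l2 l3 by (simp add: algebra_simps)
  then have M: "invertible5 M"
    unfolding invertible5_def using c assms(1) by (simp only: unit5_multI not_False_eq_True)
  have rows: "mulv (transp M) (1, 0, 0) = smul c1 l1" "mulv (transp M) (0, 1, 0) = smul c2 l2"
    "mulv (transp M) (0, 0, 1) = smul c3 l3"
    unfolding M_def l1 l2 l3 by simp_all
  \<comment> \<open>Cramer's rule\<close>
  have sum: "mulv (transp M) (1, 1, 1) = smul (det3 (l1, l2, l3)) l4"
    unfolding M_def c_defs l1 l2 l3 l4 by (simp add: algebra_simps)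
  have inc: "incident e (act M p) \<longleftrightarrow> incident l p"
    if "p \<in> pts" "mulv (transp M) e = smul k l" "k mod 5 \<noteq> 0" for p e k l
    unfolding incident_act[OF M that(1)] that(2) by (rule incident_peq(2)[OF peq_smul[OF that(3)]])
  show thesis
    by (rule that[OF M inc[OF _ rows(1) c(1)] inc[OF _ rows(2) c(2)] inc[OF _ rows(3) c(3)] inc[OF _ sum assms(1)]])
qed

text \<open>Read as lines: the triangle of reference and the unit line
  \<open>x + y + z = 0\<close>.\<close>

definition frame :: "vec list" where
  "frame = [(1, 0, 0), (0, 1, 0), (0, 0, 1), (1, 1, 1)]"

definition uncovered :: "vec list \<Rightarrow> vec list" where
  "uncovered ls = filter (\<lambda>p. list_all (\<lambda>l. \<not> incident l p) ls) point_list"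

text \<open>The dual conics through the frame are \<open>a * x * y + b * x * z + c * y * z = 0\<close> with
  \<open>a + b + c = 0\<close>; up to scaling the coefficients are a permutation of \<open>1, 1, 3\<close>, and each such
  conic contains exactly two further lines. The matrices are the adjugates of the dual conics.\<close>
definition frame_conics :: "(vec \<times> vec \<times> mat) list" where
  "frame_conics =
    [((1, 2, 4), (1, 4, 2), ((-9, 3, 3), (3, -1, 1), (3, 1, -1))),
     ((1, 3, 2), (1, 4, 3), ((-1, 3, 1), (3, -9, 3), (1, 3, -1))),
     ((1, 2, 3), (1, 3, 4), ((-1, 1, 3), (1, -1, 3), (3, 3, -9)))]"

text \<open>The six lines are the tangents of the conic. Each conic point lies on its own tangent,
  so the points on no tangent are the interior points; both sides filter \<open>point_list\<close>,
  so they agree even as lists.\<close>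

lemma frame_conics_interior:
  assumes "(m, m', A) \<in> set frame_conics"
  shows "irreducible_conic_matrix A" "set (uncovered (m # m' # frame)) = interior_pts A"
proof -
  have "uncovered ((1, 2, 4) # (1, 4, 2) # frame) = interior_list ((-9, 3, 3), (3, -1, 1), (3, 1, -1))"
    by code_simp
  moreover have "uncovered ((1, 3, 2) # (1, 4, 3) # frame) = interior_list ((-1, 3, 1), (3, -9, 3), (1, 3, -1))"
    by code_simp
  moreover have "uncovered ((1, 2, 3) # (1, 3, 4) # frame) = interior_list ((-1, 1, 3), (1, -1, 3), (3, 3, -9))"
    by code_simp
  ultimately have "uncovered (m # m' # frame) = interior_list A"
    using assms unfolding frame_conics_def by auto
  then show "set (uncovered (m # m' # frame)) = interior_pts A" by (simp only: set_interior_list)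
  show "irreducible_conic_matrix A"
    using assms unfolding frame_conics_def irreducible_conic_matrix_def by auto
qed

lemma frame_completion:
  assumes m: "m \<in> pts" "m' \<in> pts"
    and 1: "\<And>k l. k \<in> set frame \<Longrightarrow> l \<in> set frame \<Longrightarrow> k \<noteq> l \<Longrightarrow> det3 (k, l, m) mod 5 \<noteq> 0"
      "\<And>k l. k \<in> set frame \<Longrightarrow> l \<in> set frame \<Longrightarrow> k \<noteq> l \<Longrightarrow> det3 (k, l, m') mod 5 \<noteq> 0"
    and 2: "\<And>k. k \<in> set frame \<Longrightarrow> det3 (k, m, m') mod 5 \<noteq> 0"
  shows "\<exists>A. (m, m', A) \<in> set frame_conics \<or> (m', m, A) \<in> set frame_conics"
proof -
  \<comment> \<open>The lines in general position to the frame: \<open>(1, y, z)\<close> with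
    \<open>1\<close>, \<open>y\<close>, \<open>z\<close> distinct and nonzero.\<close>
  define C :: "vec list" where
    "C = [(1, 2, 3), (1, 2, 4), (1, 3, 2), (1, 3, 4), (1, 4, 2), (1, 4, 3)]"
  define P :: "(vec \<times> vec) list" where
    "P = [((1, 0, 0), (0, 1, 0)), ((1, 0, 0), (0, 0, 1)), ((1, 0, 0), (1, 1, 1)),
      ((0, 1, 0), (0, 0, 1)), ((0, 1, 0), (1, 1, 1)), ((0, 0, 1), (1, 1, 1))]"
  \<comment> \<open>The pairs left by the conditions that involve both \<open>m\<close> and
    \<open>m'\<close>: each candidate has a single possible partner.\<close>
  define Q :: "(vec \<times> vec) list" where
    "Q = [((1, 2, 4), (1, 4, 2)), ((1, 4, 2), (1, 2, 4)), ((1, 3, 2), (1, 4, 3)),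
      ((1, 4, 3), (1, 3, 2)), ((1, 2, 3), (1, 3, 4)), ((1, 3, 4), (1, 2, 3))]"
  have "list_all (\<lambda>m. list_all (\<lambda>(k, l). det3 (k, l, m) mod 5 \<noteq> 0) P \<longrightarrow> m \<in> set C) point_list"
    unfolding P_def C_def by code_simp
  then have C: "m \<in> set C" if "m \<in> pts" "list_all (\<lambda>(k, l). det3 (k, l, m) mod 5 \<noteq> 0) P" for m
    using that unfolding list_all_iff[of _ point_list] pts_eq_set_point_list by blast
  have "\<forall>(k, l)\<in>set P. k \<in> set frame \<and> l \<in> set frame \<and> k \<noteq> l"
    by (simp add: P_def frame_def)
  then have mC: "m \<in> set C" "m' \<in> set C" using m 1 by (intro C; fastforce simp: list_all_iff)+
  have "list_all (\<lambda>m. list_all (\<lambda>m'. list_all (\<lambda>k. det3 (k, m, m') mod 5 \<noteq> 0)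
      [(1, 0, 0), (0, 1, 0), (0, 0, 1), (1, 1, 1)] \<longrightarrow> (m, m') \<in> set Q) C) C"
    unfolding C_def Q_def by code_simp
  note Q = this[folded frame_def, unfolded list_all_iff[of _ C], rule_format]
  have "(m, m') \<in> set Q"
    by (rule Q[OF mC]) (unfold list_all_iff, intro ballI 2)
  then show ?thesis unfolding Q_def frame_conics_def by auto
qed

text \<open>The dual arc argument is used twice: on \<open>S\<close>, to find four lines that can be
  moved to the frame, and on the image \<open>S'\<close>, to identify its two remaining external
  lines.\<close>

lemma tangent_free_no_5_secant:
  assumes S: "tangent_free S" "card S = 10"
    and no5: "\<forall>l\<in>pts. card (S \<inter> line_set l) < 5"
  obtains A where "irreducible_conic_matrix A" "proj_equiv S (interior_pts A)"
proof -
  have Sp: "S \<subseteq> pts" using S(1) unfolding tangent_free_def by blast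
  let ?E = "external_lines S"
  have Ep: "external_lines S \<subseteq> pts" for S unfolding external_lines_def by blast
  note oval = external_lines_dual_oval[OF S no5]
  have "finite ?E" using Ep finite_pts finite_subset by blast
  then obtain ls where ls: "set ls = ?E" "distinct ls" using finite_distinct_list by blast
  then have "length ls = 6" using oval(1) distinct_card by metis
  then obtain l1 l2 l3 l4 l5 l6 where "ls = [l1, l2, l3, l4, l5, l6]"
    by (auto simp: numeral_eq_Suc length_Suc_conv)
  then have l: "l1 \<in> ?E" "l2 \<in> ?E" "l3 \<in> ?E" "l4 \<in> ?E"
    and ne: "l1 \<noteq> l2" "l1 \<noteq> l3" "l1 \<noteq> l4" "l2 \<noteq> l3" "l2 \<noteq> l4" "l3 \<noteq> l4"
    using ls by auto
  note arc = dual_arc_det3[OF Ep oval(3)]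
  note dets = arc[OF l(1,2,3) ne(1,2,4)] arc[OF l(4,2,3) ne(5,6)[THEN not_sym] ne(4)]
    arc[OF l(1,4,3) ne(3,2) ne(6)[THEN not_sym]] arc[OF l(1,2,4) ne(1,3,5)]
  obtain M where M: "invertible5 M"
    "\<And>p. p \<in> pts \<Longrightarrow> incident (1, 0, 0) (act M p) \<longleftrightarrow> incident l1 p"
    "\<And>p. p \<in> pts \<Longrightarrow> incident (0, 1, 0) (act M p) \<longleftrightarrow> incident l2 p"
    "\<And>p. p \<in> pts \<Longrightarrow> incident (0, 0, 1) (act M p) \<longleftrightarrow> incident l3 p"
    "\<And>p. p \<in> pts \<Longrightarrow> incident (1, 1, 1) (act M p) \<longleftrightarrow> incident l4 p"
    by (rule frame_map[OF dets], rule that)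
  define S' where "S' = act M ` S"
  have SS': "proj_equiv S S'" using proj_equivI[OF M(1) Sp] unfolding S'_def by blast
  have S': "tangent_free S'" "card S' = 10"
    using tangent_free_proj_equiv[OF SS' S(1)] card_proj_equiv[OF SS' Sp] S(2) by simp_all
  have no5': "\<forall>l\<in>pts. card (S' \<inter> line_set l) < 5"
  proof
    fix l assume "l \<in> pts"
    then have "\<exists>m\<in>pts. card (S \<inter> line_set m) = card (S' \<inter> line_set l)"
      using line_card_proj_equiv[OF SS' Sp] by blast
    then show "card (S' \<inter> line_set l) < 5" using no5 by metis
  qed
  let ?E' = "external_lines S'"
  note oval' = external_lines_dual_oval[OF S' no5']
  note arc' = dual_arc_det3[OF Ep oval'(3)]
  have ext: "e \<in> ?E'" if e: "e \<in> pts" "l \<in> ?E" "\<And>p. p \<in> pts \<Longrightarrow> incident e (act M p) \<longleftrightarrow> incident l p" for e l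
  proof -
    have "\<not> incident e q" if q: "q \<in> S'" for q
    proof -
      obtain p where p: "p \<in> S" "q = act M p" using q unfolding S'_def by blast
      then have "p \<in> pts" using Sp by blast
      then have "\<not> incident l p" using e(2) p unfolding external_lines_def line_set_def by blast
      then show ?thesis using e(3)[OF \<open>p \<in> pts\<close>] p(2) by simp
    qed
    then show ?thesis using e(1) unfolding external_lines_def line_set_def by blast
  qed
  have "(1, 0, 0) \<in> ?E'" by (rule ext[OF _ l(1) M(2)]) (simp_all add: mem_pts)
  moreover have "(0, 1, 0) \<in> ?E'" by (rule ext[OF _ l(2) M(3)]) (simp_all add: mem_pts)
  moreover have "(0, 0, 1) \<in> ?E'" by (rule ext[OF _ l(3) M(4)]) (simp_all add: mem_pts)
  moreover have "(1, 1, 1) \<in> ?E'" by (rule ext[OF _ l(4) M(5)]) (simp_all add: mem_pts)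
  ultimately have F: "set frame \<subseteq> ?E'" unfolding frame_def by simp
  have "card (set frame) = 4" by (simp add: frame_def)
  then have "card (?E' - set frame) = 2" using card_Diff_subset[OF _ F] oval'(1) by simp
  then obtain m m' where mm: "?E' - set frame = {m, m'}" "m \<noteq> m'" by (auto simp: card_2_iff)
  then have m: "m \<in> ?E'" "m' \<in> ?E'" "m \<notin> set frame" "m' \<notin> set frame" by blast+
  have "\<exists>A. (m, m', A) \<in> set frame_conics \<or> (m', m, A) \<in> set frame_conics"
  proof (rule frame_completion)
    show "m \<in> pts" "m' \<in> pts" using m Ep by blast+
    show "det3 (k, l, m) mod 5 \<noteq> 0" if "k \<in> set frame" "l \<in> set frame" "k \<noteq> l" for k l
      by (rule arc') (use that F m in blast)+
    show "det3 (k, l, m') mod 5 \<noteq> 0" if "k \<in> set frame" "l \<in> set frame" "k \<noteq> l" for k l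
      by (rule arc') (use that F m in blast)+
    show "det3 (k, m, m') mod 5 \<noteq> 0" if "k \<in> set frame" for k
      by (rule arc') (use that F m mm(2) in blast)+
  qed
  \<comment> \<open>\<open>frame_conics\<close> lists each pair in one order only, so
    \<open>m\<close> and \<open>m'\<close> may have to be swapped.\<close>
  then obtain n n' A where A: "(n, n', A) \<in> set frame_conics" "{n, n'} = {m, m'}" by blast
  have "S' = {p \<in> pts. \<forall>l\<in>?E'. \<not> incident l p}" by (rule oval'(2))
  also have "?E' = set (n # n' # frame)" using mm(1) F A(2) by auto
  also have "{p \<in> pts. \<forall>l\<in>set (n # n' # frame). \<not> incident l p} = set (uncovered (n # n' # frame))"
    unfolding uncovered_def Collect_pts list_all_iff ..
  also have "\<dots> = interior_pts A" by (rule frame_conics_interior(2)[OF A(1)])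
  finally have "proj_equiv S (interior_pts A)" using SS' by simp
  then show thesis using that frame_conics_interior(1)[OF A(1)] by blast
qed

section \<open>Assembling the classification from one representative of each type\<close>

theorem mainTheorem8:
  shows "(\<forall>S. tangent_free S \<and> card S = 10 \<longrightarrow>
            (\<exists>T. trivial_set T \<and> proj_equiv S T) \<or> (\<exists>T. conic_interior_set T \<and> proj_equiv S T))
       \<and> (\<forall>T. trivial_set T \<longrightarrow> tangent_free T \<and> card T = 10)
       \<and> (\<forall>T. conic_interior_set T \<longrightarrow> tangent_free T \<and> card T = 10)
       \<and> (\<forall>T T'. trivial_set T \<and> trivial_set T' \<longrightarrow> proj_equiv T T')
       \<and> (\<forall>T T'. conic_interior_set T \<and> conic_interior_set T' \<longrightarrow> proj_equiv T T')
       \<and> (\<forall>T T'. trivial_set T \<and> conic_interior_set T' \<longrightarrow> \<not> proj_equiv T T')"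
proof -
  \<comment> \<open>Conic sets are compared with this set and trivial sets with
    \<open>cross_set\<close>; size and tangent-freeness are inherited from the
    representatives.\<close>
  let ?I = "interior_pts (diag 1 1 1)"
  have conic: "T \<subseteq> pts" "proj_equiv T ?I" if "conic_interior_set T" for T
    using that irreducible_conic_equiv interior_pts_subset unfolding conic_interior_set_def by blast+
  note triv = trivial_set_cross_set
  have equiv: "proj_equiv T T'" if "proj_equiv T U" "proj_equiv T' U" "T \<subseteq> pts" "T' \<subseteq> pts" for T T' U
    by (rule proj_equiv_trans[OF that(1) proj_equiv_sym[OF that(2,4)] that(3)])
  have props: "tangent_free T \<and> card T = 10"
    if "proj_equiv T U" "T \<subseteq> pts" "tangent_free U" "card U = 10" for T U
  proof -
    have U: "U \<subseteq> pts" using that(3) unfolding tangent_free_def by blast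
    note sym = proj_equiv_sym[OF that(1,2)]
    show ?thesis using tangent_free_proj_equiv[OF sym that(3)] card_proj_equiv[OF sym U] that(4) by simp
  qed
  have 1: "(\<exists>T. trivial_set T \<and> proj_equiv S T) \<or> (\<exists>T. conic_interior_set T \<and> proj_equiv S T)"
    if S: "tangent_free S" "card S = 10" for S
  proof (cases "\<exists>l\<in>pts. card (S \<inter> line_set l) \<ge> 5")
    case True
    then have "trivial_set S" using tangent_free_5_secant_trivial[OF S] by blast
    moreover have "proj_equiv S S" using S(1) proj_equiv_refl unfolding tangent_free_def by blast
    ultimately show ?thesis by blast
  next
    case False
    then have "\<forall>l\<in>pts. card (S \<inter> line_set l) < 5" by (meson not_le)
    from tangent_free_no_5_secant[OF S this] show ?thesis unfolding conic_interior_set_def by blast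
  qed
  have 6: "\<not> proj_equiv T T'" if T: "trivial_set T" "conic_interior_set T'" for T T'
  proof
    assume TT': "proj_equiv T T'"
    have "\<exists>l\<in>pts. card (T \<inter> line_set l) = 5"
      using line_card_proj_equiv[OF triv(2,1)[OF T(1)]] cross_set_properties(3) by blast
    then have "\<exists>l\<in>pts. card (T' \<inter> line_set l) = 5"
      using line_card_proj_equiv[OF TT' triv(1)[OF T(1)]] by blast
    then have "\<exists>l\<in>pts. card (?I \<inter> line_set l) = 5"
      using line_card_proj_equiv[OF conic(2,1)[OF T(2)]] by blast
    then show False using interior_diag_properties(3) by blast
  qed
  show ?thesis
  proof (intro conjI allI impI)
    fix S assume "tangent_free S \<and> card S = 10"
    then show "(\<exists>T. trivial_set T \<and> proj_equiv S T) \<or> (\<exists>T. conic_interior_set T \<and> proj_equiv S T)"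
      using 1 by blast
  next
    fix T assume T: "trivial_set T"
    from props[OF triv(2,1)[OF T] cross_set_properties(1,2)]
    show "tangent_free T" "card T = 10" by blast+
  next
    fix T assume T: "conic_interior_set T"
    from props[OF conic(2,1)[OF T] interior_diag_properties(1,2)]
    show "tangent_free T" "card T = 10" by blast+
  next
    fix T T' assume "trivial_set T \<and> trivial_set T'"
    then show "proj_equiv T T'" using equiv triv by blast
  next
    fix T T' assume "conic_interior_set T \<and> conic_interior_set T'"
    then show "proj_equiv T T'" using equiv conic by blast
  next
    fix T T' assume "trivial_set T \<and> conic_interior_set T'"
    then show "\<not> proj_equiv T T'" using 6 by blast
  qed
qed

end
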